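(* Let $K$ be a finite simplicial complex, $k$ a field of characteristic $0$, $A^2$ a finite-dimensional normed $k$-vector space with norm $\|\cdot\|$, and $(\phi_c)_{c\in A^2}$ a family of filtration functions $\phi_c:\mathrm{Simp}(K)\to\mathbb{R}$. Let $c,c'\in A^2$ and set $$\Delta:=\|\phi_c-\phi_{c'}\|_\infty=\sup_{\sigma\in\mathrm{Simp}(K)}|\phi_c(\sigma)-\phi_{c'}(\sigma)|.$$ Then the interleaving distance (equivalently, the bottleneck distance of the barcodes) between the persistence modules $H_\ast(C_\bullet,F^{\,c}_\bullet)$ and $H_\ast(C_\bullet,F^{\,c'}_\bullet)$ is at most $\Delta$. In particular, if $L\ge 0$ is a constant such that $\|\phi_{a}-\phi_{a'}\|_\infty\le L\,\|a-a'\|$ for all $a,a'\in A^2$, then $$d_I\big(H_\ast(C_\bullet,F^{\,c}_\bullet),\,H_\ast(C_\bullet,F^{\,c'}_\bullet)\big)\le L\,\|c-c'\|.$$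
   Context: $A^2$ is the degree-$2$ component of a $\mathbb{Z}$-graded associative unital algebra $A^\bullet$ over $k$ (underlying a curved dg-algebra) with finite-dimensional graded components; the norm on $A^2$ is taken with respect to a fixed absolute value on $k$. $\mathrm{Simp}(K)$ is the set of simplices of $K$. A filtration function is a function $\phi:\mathrm{Simp}(K)\to\mathbb{R}$ that is monotone under the face relation ($\phi(\tau)\le\phi(\sigma)$ whenever $\tau$ is a face of $\sigma$), so that sublevel sets are subcomplexes. $(C_\bullet,\partial)=(C_\bullet(K;k),\partial)$ is the simplicial chain complex of $K$ with coefficients in $k$. For $c\in A^2$, a simplex $\sigma$ enters at time $t=\phi_c(\sigma)$: $F^{\,c}_t$ is the chain subcomplex spanned by the simplices $\sigma$ with $\phi_c(\sigma)\le t$, and $(C_\bullet,F^{\,c}_\bullet)$ is the resulting filtered chain complex. $H_\ast(C_\bullet,F^{\,c}_\bullet)$ is the $\mathbb{R}$-indexed persistence module $t\mapsto H_\ast(F^{\,c}_t)$ obtained by applying homology in each homological degree, with maps induced by inclusions. $d_I$ is the interleaving distance of persistence modules. *)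

theory Defs
  imports
    "HOL-Analysis.Analysis"
    "HOL-Algebra.AbelCoset"
    "HOL-Algebra.Module"
    "HOL-Algebra.Algebraic_Closure_Type"
    "HOL-Library.Multiset"
begin

subsection \<open>Normed vector spaces over a valued field\<close>

definition absolute_value :: "('k::field \<Rightarrow> real) \<Rightarrow> bool" where
  "absolute_value absv \<longleftrightarrow>
     (\<forall>x. 0 \<le> absv x) \<and> (\<forall>x. absv x = 0 \<longleftrightarrow> x = 0) \<and>
     (\<forall>x y. absv (x * y) = absv x * absv y) \<and>
     (\<forall>x y. absv (x + y) \<le> absv x + absv y)"

definition norm_wrt ::
  "('k::field \<Rightarrow> real) \<Rightarrow> ('k \<Rightarrow> 'a::ab_group_add \<Rightarrow> 'a) \<Rightarrow> ('a \<Rightarrow> real) \<Rightarrow> bool" where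
  "norm_wrt absv sc nrm \<longleftrightarrow>
     (\<forall>x. 0 \<le> nrm x) \<and> (\<forall>x. nrm x = 0 \<longleftrightarrow> x = 0) \<and>
     (\<forall>r x. nrm (sc r x) = absv r * nrm x) \<and>
     (\<forall>x y. nrm (x + y) \<le> nrm x + nrm y)"

subsection \<open>Simplicial complexes and filtration functions\<close>

definition finite_simplicial_complex :: "'v set set \<Rightarrow> bool" where
  "finite_simplicial_complex K \<longleftrightarrow>
     finite K \<and> (\<forall>\<sigma>\<in>K. finite \<sigma> \<and> \<sigma> \<noteq> {}) \<and>
     (\<forall>\<sigma>\<in>K. \<forall>\<tau>. \<tau> \<subseteq> \<sigma> \<and> \<tau> \<noteq> {} \<longrightarrow> \<tau> \<in> K)"

definition filtration_function :: "'v set set \<Rightarrow> ('v set \<Rightarrow> real) \<Rightarrow> bool" where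
  "filtration_function K f \<longleftrightarrow> (\<forall>\<sigma>\<in>K. \<forall>\<tau>\<in>K. \<tau> \<subseteq> \<sigma> \<longrightarrow> f \<tau> \<le> f \<sigma>)"

text \<open>The supremum is taken in the extended nonnegative reals, so that it is 0 for the empty complex.\<close>

definition sup_dist :: "'v set set \<Rightarrow> ('v set \<Rightarrow> real) \<Rightarrow> ('v set \<Rightarrow> real) \<Rightarrow> ennreal" where
  "sup_dist K f g = (SUP \<sigma>\<in>K. ennreal \<bar>f \<sigma> - g \<sigma>\<bar>)"

definition sublevel :: "'v set set \<Rightarrow> ('v set \<Rightarrow> real) \<Rightarrow> real \<Rightarrow> 'v set set" where
  "sublevel K f t = {\<sigma> \<in> K. f \<sigma> \<le> t}"

subsection \<open>Linear maps and quotients of vector spaces\<close>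

text \<open>
  Vector spaces over \<open>'k\<close> are modules over \<^term>\<open>ring_of_type_algebra :: 'k::field ring\<close>.
  The fields \<open>mult\<close> and \<open>one\<close> of the module record play no role.
\<close>

definition linear_maps :: "('k, 'a) module \<Rightarrow> ('k, 'b) module \<Rightarrow> ('a \<Rightarrow> 'b) set" where
  "linear_maps V W = {h \<in> carrier V \<rightarrow> carrier W.
     (\<forall>x\<in>carrier V. \<forall>y\<in>carrier V. h (x \<oplus>\<^bsub>V\<^esub> y) = h x \<oplus>\<^bsub>W\<^esub> h y) \<and>
     (\<forall>a. \<forall>x\<in>carrier V. h (a \<odot>\<^bsub>V\<^esub> x) = a \<odot>\<^bsub>W\<^esub> h x)}"

definition quotient_module :: "('k, 'a) module \<Rightarrow> 'a set \<Rightarrow> ('k, 'a set) module" where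
  "quotient_module V N =
     \<lparr>carrier = a_rcosets\<^bsub>V\<^esub> N, mult = undefined, one = undefined,
      zero = N, add = set_add V,
      smult = (\<lambda>a A. \<Union>x\<in>A. N +>\<^bsub>V\<^esub> (a \<odot>\<^bsub>V\<^esub> x))\<rparr>"

text \<open>Functions supported on \<open>S\<close>, with pointwise operations; for finite \<open>S\<close> this is the
  vector space with basis \<open>S\<close>.\<close>

definition functions_on :: "'i set \<Rightarrow> ('k::field, 'i \<Rightarrow> 'k) module" where
  "functions_on S =
     \<lparr>carrier = {x. \<forall>i. x i \<noteq> 0 \<longrightarrow> i \<in> S}, mult = undefined, one = undefined,
      zero = (\<lambda>i. 0), add = (\<lambda>x y i. x i + y i), smult = (\<lambda>a x i. a * x i)\<rparr>"

subsection \<open>Simplicial homology with field coefficients\<close>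

type_synonym ('v, 'k) chain = "'v set \<Rightarrow> 'k"

text \<open>If \<open>K\<close> is a complex and \<open>S \<subseteq> K\<close> a subcomplex, then \<open>chain_space S n\<close> is the subspace of the
  \<open>n\<close>-chains of \<open>K\<close> spanned by the simplices of \<open>S\<close>.\<close>

definition chain_space :: "'v set set \<Rightarrow> nat \<Rightarrow> ('k::field, ('v, 'k) chain) module" where
  "chain_space S n = functions_on {\<sigma> \<in> S. card \<sigma> = Suc n}"

text \<open>Simplices are oriented by the order of the vertices: for \<open>v\<^sub>0 < \<dots> < v\<^sub>n\<close> the boundary is
  the sum of the faces \<open>[v\<^sub>0, \<dots>, v\<^sub>n] - v\<^sub>i\<close> with signs \<open>(- 1) ^ i\<close>. The empty set is not a simplex,
  hence a vertex has boundary 0 (homology is unreduced).\<close>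

definition simplex_boundary :: "'v::linorder set \<Rightarrow> ('v, 'k::field) chain" where
  "simplex_boundary \<sigma> =
     (\<lambda>\<tau>. \<Sum>v\<in>\<sigma>. if \<tau> = \<sigma> - {v} \<and> \<tau> \<noteq> {} then (- 1) ^ card {w \<in> \<sigma>. w < v} else 0)"

definition boundary :: "('v::linorder, 'k::field) chain \<Rightarrow> ('v, 'k) chain" where
  "boundary x = (\<lambda>\<tau>. \<Sum>\<sigma> | x \<sigma> \<noteq> 0. x \<sigma> * simplex_boundary \<sigma> \<tau>)"

definition cycles :: "'v::linorder set set \<Rightarrow> nat \<Rightarrow> ('v, 'k::field) chain set" where
  "cycles S n = {x \<in> carrier (chain_space S n). boundary x = (\<lambda>\<tau>. 0)}"

definition boundaries :: "'v::linorder set set \<Rightarrow> nat \<Rightarrow> ('v, 'k::field) chain set" where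
  "boundaries S n = boundary ` carrier (chain_space S (Suc n))"

definition homology ::
  "'v::linorder set set \<Rightarrow> nat \<Rightarrow> ('k::field, ('v, 'k) chain set) module" where
  "homology S n = quotient_module ((chain_space S n)\<lparr>carrier := cycles S n\<rparr>) (boundaries S n)"

definition homology_inclusion ::
  "'v::linorder set set \<Rightarrow> nat \<Rightarrow> ('v, 'k::field) chain set \<Rightarrow> ('v, 'k) chain set" where
  "homology_inclusion T n A = (\<Union>x\<in>A. boundaries T n +>\<^bsub>chain_space T n\<^esub> x)"

subsection \<open>Persistence modules and the interleaving distance\<close>

record ('k, 'a) pmod =
  pspace :: "real \<Rightarrow> ('k, 'a) module"
  pmap :: "real \<Rightarrow> real \<Rightarrow> 'a \<Rightarrow> 'a"

text \<open>The structure map \<open>pmap M s t\<close> is only meaningful for \<open>s \<le> t\<close>.\<close>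

locale persistence_module =
  fixes M :: "('k::field, 'a) pmod"
  assumes module: "Module.module ring_of_type_algebra (pspace M t)"
    and linear: "s \<le> t \<Longrightarrow> pmap M s t \<in> linear_maps (pspace M s) (pspace M t)"
    and ident: "x \<in> carrier (pspace M t) \<Longrightarrow> pmap M t t x = x"
    and comp: "\<lbrakk>r \<le> s; s \<le> t; x \<in> carrier (pspace M r)\<rbrakk> \<Longrightarrow>
      pmap M s t (pmap M r s x) = pmap M r t x"

definition shift_morphism ::
  "real \<Rightarrow> ('k, 'a) pmod \<Rightarrow> ('k, 'b) pmod \<Rightarrow> (real \<Rightarrow> 'a \<Rightarrow> 'b) \<Rightarrow> bool" where
  "shift_morphism \<delta> M N h \<longleftrightarrow>
     (\<forall>t. h t \<in> linear_maps (pspace M t) (pspace N (t + \<delta>))) \<and>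
     (\<forall>s t. s \<le> t \<longrightarrow> (\<forall>x\<in>carrier (pspace M s).
        h t (pmap M s t x) = pmap N (s + \<delta>) (t + \<delta>) (h s x)))"

definition interleaved :: "real \<Rightarrow> ('k, 'a) pmod \<Rightarrow> ('k, 'b) pmod \<Rightarrow> bool" where
  "interleaved \<delta> M N \<longleftrightarrow> 0 \<le> \<delta> \<and> (\<exists>g h. shift_morphism \<delta> M N g \<and> shift_morphism \<delta> N M h \<and>
     (\<forall>t. \<forall>x\<in>carrier (pspace M t). h (t + \<delta>) (g t x) = pmap M t (t + 2 * \<delta>) x) \<and>
     (\<forall>t. \<forall>y\<in>carrier (pspace N t). g (t + \<delta>) (h t y) = pmap N t (t + 2 * \<delta>) y))"

text \<open>Graded persistence modules are families indexed by the homological degree; morphisms, and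
  hence interleavings, preserve the degree.\<close>

definition interleaving_distance ::
  "(nat \<Rightarrow> ('k, 'a) pmod) \<Rightarrow> (nat \<Rightarrow> ('k, 'b) pmod) \<Rightarrow> ennreal" where
  "interleaving_distance M N = Inf {ennreal \<delta> | \<delta>. 0 \<le> \<delta> \<and> (\<forall>n. interleaved \<delta> (M n) (N n))}"

definition persistent_homology ::
  "'v::linorder set set \<Rightarrow> ('v set \<Rightarrow> real) \<Rightarrow> nat \<Rightarrow> ('k::field, ('v, 'k) chain set) pmod" where
  "persistent_homology K f n =
     \<lparr>pspace = (\<lambda>t. homology (sublevel K f t) n),
      pmap = (\<lambda>s t. homology_inclusion (sublevel K f t) n)\<rparr>"

subsection \<open>Barcodes and the bottleneck distance\<close>

text \<open>Bars with multiplicity: \<open>(I, i)\<close> is the \<open>i\<close>-th copy of the interval \<open>I\<close>.\<close>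

definition bars :: "real set multiset \<Rightarrow> (real set \<times> nat) set" where
  "bars B = {(I, i). i < count B I}"

text \<open>The direct sum of the interval modules of the bars in \<open>B\<close>.\<close>

definition interval_sum :: "real set multiset \<Rightarrow> ('k::field, real set \<times> nat \<Rightarrow> 'k) pmod" where
  "interval_sum B =
     \<lparr>pspace = (\<lambda>t. functions_on {b \<in> bars B. t \<in> fst b}),
      pmap = (\<lambda>s t x b. if t \<in> fst b then x b else 0)\<rparr>"

definition pmod_isomorphic :: "('k, 'a) pmod \<Rightarrow> ('k, 'b) pmod \<Rightarrow> bool" where
  "pmod_isomorphic M N \<longleftrightarrow> (\<exists>h. shift_morphism 0 M N h \<and>
     (\<forall>t. bij_betw (h t) (carrier (pspace M t)) (carrier (pspace N t))))"

text \<open>Finite multisets suffice here: the homology of a filtered finite complex is finite-dimensional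
  at each time and changes at finitely many times, so it has finitely many bars in each degree.\<close>

definition is_barcode :: "(nat \<Rightarrow> real set multiset) \<Rightarrow> (nat \<Rightarrow> ('k::field, 'a) pmod) \<Rightarrow> bool" where
  "is_barcode B M \<longleftrightarrow> (\<forall>n. (\<forall>I\<in>#B n. is_interval I \<and> I \<noteq> {}) \<and>
     pmod_isomorphic (M n) (interval_sum (B n)))"

definition birth :: "real set \<Rightarrow> ereal" where
  "birth I = Inf (ereal ` I)"

definition death :: "real set \<Rightarrow> ereal" where
  "death I = Sup (ereal ` I)"

text \<open>A \<open>\<delta>\<close>-matching is a partial bijection between bars: the endpoints of matched bars
  differ by at most \<open>\<delta>\<close> (infinite endpoints only match equal ones), and unmatched bars have
  length at most \<open>2 * \<delta>\<close>.\<close>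

definition matching ::
  "real \<Rightarrow> real set multiset \<Rightarrow> real set multiset \<Rightarrow> ((real set \<times> nat) \<times> (real set \<times> nat)) set \<Rightarrow> bool"
  where
  "matching \<delta> B B' m \<longleftrightarrow>
     m \<subseteq> bars B \<times> bars B' \<and> inj_on fst m \<and> inj_on snd m \<and>
     (\<forall>((I, i), (J, j))\<in>m.
        birth I \<le> birth J + ereal \<delta> \<and> birth J \<le> birth I + ereal \<delta> \<and>
        death I \<le> death J + ereal \<delta> \<and> death J \<le> death I + ereal \<delta>) \<and>
     (\<forall>(I, i)\<in>bars B - fst ` m. death I \<le> birth I + ereal (2 * \<delta>)) \<and>
     (\<forall>(J, j)\<in>bars B' - snd ` m. death J \<le> birth J + ereal (2 * \<delta>))"

definition bottleneck_distance ::
  "(nat \<Rightarrow> real set multiset) \<Rightarrow> (nat \<Rightarrow> real set multiset) \<Rightarrow> ennreal" where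
  "bottleneck_distance B B' =
     Inf {ennreal \<delta> | \<delta>. 0 \<le> \<delta> \<and> (\<forall>n. \<exists>m. matching \<delta> (B n) (B' n) m)}"

subsection \<open>Persistent homology and sums of interval modules are persistence modules\<close>

lemma module_functions_on: "Module.module ring_of_type_algebra (functions_on S :: ('k::field, 'i \<Rightarrow> 'k) module)"
proof (rule moduleI)
  show "cring (ring_of_type_algebra :: 'k ring)" by (rule cring_from_type_algebra)
  show "abelian_group (functions_on S :: ('k::field, 'i \<Rightarrow> 'k) module)"
  proof (rule abelian_groupI)
    fix x :: "'i \<Rightarrow> 'k" assume x: "x \<in> carrier (functions_on S)"
    have "(\<lambda>i. - x i) \<in> carrier (functions_on S)" using x by (auto simp: functions_on_def)
    then show "\<exists>y\<in>carrier (functions_on S). y \<oplus>\<^bsub>functions_on S\<^esub> x = \<zero>\<^bsub>functions_on S\<^esub>"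
      by (rule bexI[rotated]) (auto simp: functions_on_def)
  qed (auto simp: functions_on_def fun_eq_iff, (metis add.right_neutral add_cancel_right_left)?)
qed (auto simp: functions_on_def ring_of_type_algebra_def algebra_simps fun_eq_iff)

lemma boundary_eq:
  assumes "finite S" "\<And>\<sigma>. x \<sigma> \<noteq> 0 \<Longrightarrow> \<sigma> \<in> S"
  shows "boundary x \<tau> = (\<Sum>\<sigma>\<in>S. x \<sigma> * simplex_boundary \<sigma> \<tau>)"
  unfolding boundary_def by (rule sum.mono_neutral_left) (use assms in auto)

lemma simplex_boundary_nonzeroD: "simplex_boundary \<sigma> \<rho> \<noteq> 0 \<Longrightarrow> \<exists>v\<in>\<sigma>. \<rho> = \<sigma> - {v} \<and> \<rho> \<noteq> {}"
proof (rule ccontr)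
  assume nz: "simplex_boundary \<sigma> \<rho> \<noteq> (0 :: 'k::field)" and "\<not> (\<exists>v\<in>\<sigma>. \<rho> = \<sigma> - {v} \<and> \<rho> \<noteq> {})"
  then have "(simplex_boundary \<sigma> \<rho> :: 'k) = (\<Sum>v\<in>\<sigma>. 0)"
    unfolding simplex_boundary_def by (intro sum.cong refl) auto
  with nz show False by simp
qed

lemma boundary_nonzeroD:
  fixes x :: "('v::linorder, 'k::field) chain"
  assumes "boundary x \<rho> \<noteq> 0" shows "\<exists>\<sigma>. x \<sigma> \<noteq> 0 \<and> simplex_boundary \<sigma> \<rho> \<noteq> (0 :: 'k)"
proof (rule ccontr)
  assume "\<not> ?thesis"
  then have "boundary x \<rho> = (\<Sum>\<sigma> | x \<sigma> \<noteq> 0. 0)"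
    unfolding boundary_def by (intro sum.cong refl) auto
  with assms show False by simp
qed

lemma finite_simplicial_complexD: assumes "finite_simplicial_complex K"
  shows "finite K" "\<sigma> \<in> K \<Longrightarrow> finite \<sigma>" "\<sigma> \<in> K \<Longrightarrow> \<tau> \<subseteq> \<sigma> \<Longrightarrow> \<tau> \<noteq> {} \<Longrightarrow> \<tau> \<in> K"
  using assms unfolding finite_simplicial_complex_def by blast+

lemma face_sign_swap:
  fixes v w :: "'v::linorder"
  assumes fin: "finite \<sigma>" and v: "v \<in> \<sigma>" and w: "w \<in> \<sigma>" and lt: "v < w"
  shows "(- 1 :: 'k::field) ^ card {u \<in> \<sigma>. u < v} * (- 1) ^ card {u \<in> \<sigma> - {v}. u < w} =
    - ((- 1) ^ card {u \<in> \<sigma>. u < w} * (- 1) ^ card {u \<in> \<sigma> - {w}. u < v})"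
proof -
  have 1: "{u \<in> \<sigma> - {w}. u < v} = {u \<in> \<sigma>. u < v}" using lt by auto
  have "{u \<in> \<sigma>. u < w} = insert v {u \<in> \<sigma> - {v}. u < w}" using lt v by auto
  then have 2: "card {u \<in> \<sigma>. u < w} = Suc (card {u \<in> \<sigma> - {v}. u < w})"
    using fin by (simp add: card_insert_if)
  show ?thesis unfolding 1 2 by simp
qed

lemma simplex_boundary_boundary:
  fixes \<sigma> :: "'v::linorder set"
  assumes fin: "finite \<sigma>"
  shows "(\<Sum>v\<in>\<sigma>. if \<sigma> - {v} \<noteq> {}
      then (- 1) ^ card {u \<in> \<sigma>. u < v} * (simplex_boundary (\<sigma> - {v}) \<tau> :: 'k::field_char_0) else 0) = 0"
    (is "?L = 0")
proof -
  define g :: "'v \<Rightarrow> 'v \<Rightarrow> 'k" where "g = (\<lambda>v w.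
    if v \<noteq> w \<and> \<tau> = \<sigma> - {v, w} \<and> \<tau> \<noteq> {}
    then (- 1) ^ card {u \<in> \<sigma>. u < v} * (- 1) ^ card {u \<in> \<sigma> - {v}. u < w} else 0)"
  have anti: "g v w = - g w v" if "v \<in> \<sigma>" "w \<in> \<sigma>" for v w
  proof (cases v w rule: linorder_cases)
    case less
    then show ?thesis using face_sign_swap[OF fin that less] by (auto simp: g_def insert_commute)
  next
    case greater
    then show ?thesis using face_sign_swap[OF fin that(2,1) greater, where 'k='k] by (auto simp: g_def insert_commute)
  qed (auto simp: g_def)
  have "?L = (\<Sum>v\<in>\<sigma>. \<Sum>w\<in>\<sigma>. g v w)"
  proof (rule sum.cong[OF refl])
    fix v assume v: "v \<in> \<sigma>"
    have "(\<Sum>w\<in>\<sigma>. g v w) = (\<Sum>w\<in>\<sigma> - {v}. g v w)"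
      by (rule sum.mono_neutral_right) (use fin in \<open>auto simp: g_def\<close>)
    also have "\<dots> = (if \<sigma> - {v} \<noteq> {} then (- 1) ^ card {u \<in> \<sigma>. u < v} * (simplex_boundary (\<sigma> - {v}) \<tau> :: 'k) else 0)"
    proof (cases "\<sigma> - {v} = {}")
      case True
      then show ?thesis by (simp only: sum.empty) simp
    next
      case False
      have [simp]: "\<sigma> - {v, w} = \<sigma> - {v} - {w}" for w by auto
      have "(\<Sum>w\<in>\<sigma> - {v}. g v w) = (\<Sum>w\<in>\<sigma> - {v}. (- 1) ^ card {u \<in> \<sigma>. u < v} *
        (if \<tau> = \<sigma> - {v} - {w} \<and> \<tau> \<noteq> {} then (- 1) ^ card {u \<in> \<sigma> - {v}. u < w} else 0))"
        unfolding g_def by (intro sum.cong refl) auto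
      then show ?thesis using False unfolding simplex_boundary_def sum_distrib_left by simp
    qed
    finally show "(if \<sigma> - {v} \<noteq> {} then (- 1) ^ card {u \<in> \<sigma>. u < v} * (simplex_boundary (\<sigma> - {v}) \<tau> :: 'k) else 0) = (\<Sum>w\<in>\<sigma>. g v w)" ..
  qed
  moreover have "(\<Sum>v\<in>\<sigma>. \<Sum>w\<in>\<sigma>. g v w) = - (\<Sum>v\<in>\<sigma>. \<Sum>w\<in>\<sigma>. g v w)"
  proof -
    have "(\<Sum>v\<in>\<sigma>. \<Sum>w\<in>\<sigma>. g v w) = (\<Sum>v\<in>\<sigma>. \<Sum>w\<in>\<sigma>. - g w v)"
      by (intro sum.cong refl) (rule anti)
    also have "\<dots> = - (\<Sum>v\<in>\<sigma>. \<Sum>w\<in>\<sigma>. g v w)"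
      by (subst sum.swap) (simp add: sum_negf)
    finally show ?thesis .
  qed
  ultimately show ?thesis by simp
qed

lemma boundary_boundary:
  fixes x :: "('v::linorder, 'k::field_char_0) chain"
  assumes K: "finite_simplicial_complex K" and x: "\<And>\<sigma>. x \<sigma> \<noteq> 0 \<Longrightarrow> \<sigma> \<in> K"
  shows "boundary (boundary x) = (\<lambda>\<tau>. 0)"
proof
  fix \<tau>
  have fin: "finite K" "\<And>\<sigma>. \<sigma> \<in> K \<Longrightarrow> finite \<sigma>" and
    face: "\<And>\<sigma> v. \<sigma> \<in> K \<Longrightarrow> \<sigma> - {v} \<noteq> {} \<Longrightarrow> \<sigma> - {v} \<in> K"
    using finite_simplicial_complexD[OF K] Diff_subset by metis+
  have bx: "boundary x \<rho> = (\<Sum>\<sigma>\<in>K. x \<sigma> * simplex_boundary \<sigma> \<rho>)" for \<rho>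
    using boundary_eq[of K x] fin x by blast
  have supp: "\<rho> \<in> K" if nz: "boundary x \<rho> \<noteq> 0" for \<rho>
  proof -
    obtain \<sigma> where "\<sigma> \<in> K" "(simplex_boundary \<sigma> \<rho> :: 'k) \<noteq> 0"
      using boundary_nonzeroD[OF nz] x by blast
    then obtain v where "v \<in> \<sigma>" "\<rho> = \<sigma> - {v}" "\<rho> \<noteq> {}"
      using simplex_boundary_nonzeroD by blast
    then show ?thesis using face \<open>\<sigma> \<in> K\<close> by blast
  qed
  have inner: "(\<Sum>\<rho>\<in>K. simplex_boundary \<sigma> \<rho> * (simplex_boundary \<rho> \<tau> :: 'k)) = 0" if s: "\<sigma> \<in> K" for \<sigma>
  proof -
    have "(\<Sum>\<rho>\<in>K. simplex_boundary \<sigma> \<rho> * (simplex_boundary \<rho> \<tau> :: 'k)) =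
      (\<Sum>\<rho>\<in>K. \<Sum>v\<in>\<sigma>. if \<rho> = \<sigma> - {v} then (if \<sigma> - {v} \<noteq> {} then (- 1) ^ card {u \<in> \<sigma>. u < v} * (simplex_boundary (\<sigma> - {v}) \<tau> :: 'k) else 0) else 0)"
      unfolding simplex_boundary_def[of \<sigma>] sum_distrib_right by (intro sum.cong) auto
    also have "\<dots> = (\<Sum>v\<in>\<sigma>. if \<sigma> - {v} \<noteq> {} then (- 1) ^ card {u \<in> \<sigma>. u < v} * (simplex_boundary (\<sigma> - {v}) \<tau> :: 'k) else 0)"
      by (subst sum.swap, intro sum.cong refl) (use fin face[OF s] in \<open>auto simp: sum.delta\<close>)
    also have "\<dots> = 0" using simplex_boundary_boundary[OF fin(2)[OF s]] .
    finally show ?thesis .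
  qed
  have "boundary (boundary x) \<tau> = (\<Sum>\<rho>\<in>K. boundary x \<rho> * simplex_boundary \<rho> \<tau>)"
    using boundary_eq[of K "boundary x"] fin supp by blast
  also have "\<dots> = (\<Sum>\<sigma>\<in>K. x \<sigma> * (\<Sum>\<rho>\<in>K. simplex_boundary \<sigma> \<rho> * simplex_boundary \<rho> \<tau>))"
    unfolding bx sum_distrib_right sum_distrib_left by (subst sum.swap) (simp add: mult.assoc)
  also have "\<dots> = 0" using inner by simp
  finally show "boundary (boundary x) \<tau> = 0" .
qed

lemma coset_functions_on: "N +>\<^bsub>functions_on S\<^esub> x = {\<lambda>i. y i + x i | y. y \<in> N}"
  by (auto simp: a_r_coset_def r_coset_def functions_on_def)

lemma coset_functions_on': "N +>\<^bsub>(functions_on S)\<lparr>carrier := Z\<rparr>\<^esub> x = {\<lambda>i. y i + x i | y. y \<in> N}"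
  by (auto simp: a_r_coset_def r_coset_def functions_on_def)

definition lin_subspace :: "('i \<Rightarrow> 'k::field) set \<Rightarrow> bool" where
  "lin_subspace N \<longleftrightarrow> (\<lambda>i. 0) \<in> N \<and> (\<forall>x\<in>N. \<forall>y\<in>N. (\<lambda>i. x i + y i) \<in> N) \<and> (\<forall>a. \<forall>x\<in>N. (\<lambda>i. a * x i) \<in> N)"

lemma coset_eq_aux:
  assumes N: "lin_subspace N"
  shows "{\<lambda>i. y i + x i | y. y \<in> N} = {\<lambda>i. y i + x' i | y. y \<in> N} \<longleftrightarrow> (\<lambda>i. x i - x' i) \<in> N"
proof
  assume eq: "{\<lambda>i. y i + x i | y. y \<in> N} = {\<lambda>i. y i + x' i | y. y \<in> N}"
  have "x \<in> {\<lambda>i. y i + x i | y. y \<in> N}" using N unfolding lin_subspace_def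
    by (intro CollectI exI[of _ "\<lambda>i. 0"]) auto
  then obtain y where "y \<in> N" "x = (\<lambda>i. y i + x' i)" using eq by auto
  then show "(\<lambda>i. x i - x' i) \<in> N" by simp
next
  assume d: "(\<lambda>i. x i - x' i) \<in> N"
  have "\<forall>a. \<forall>z\<in>N. (\<lambda>i. a * z i) \<in> N" using N by (simp add: lin_subspace_def)
  from bspec[OF spec[OF this, of "- 1"] d] have d': "(\<lambda>i. x' i - x i) \<in> N" by simp
  have "\<exists>y'. (\<lambda>i. y i + x i) = (\<lambda>i. y' i + x' i) \<and> y' \<in> N" if "y \<in> N" "(\<lambda>i. x i - x' i) \<in> N" for y x x'
    by (rule exI[of _ "\<lambda>i. y i + (x i - x' i)"]) (use that N in \<open>auto simp: lin_subspace_def\<close>)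
  from this[OF _ d] this[OF _ d'] show "{\<lambda>i. y i + x i | y. y \<in> N} = {\<lambda>i. y i + x' i | y. y \<in> N}"
    by fast
qed

definition coset :: "('i \<Rightarrow> 'k::field) set \<Rightarrow> ('i \<Rightarrow> 'k) \<Rightarrow> ('i \<Rightarrow> 'k) set" where
  "coset N x = {\<lambda>i. y i + x i | y. y \<in> N}"

definition subquotient :: "'i set \<Rightarrow> ('i \<Rightarrow> 'k::field) set \<Rightarrow> ('i \<Rightarrow> 'k) set \<Rightarrow> ('k, ('i \<Rightarrow> 'k) set) module" where
  "subquotient S Z N = quotient_module ((functions_on S)\<lparr>carrier := Z\<rparr>) N"

lemma coset_mem: "z \<in> coset N x \<longleftrightarrow> (\<exists>y\<in>N. z = (\<lambda>i. y i + x i))" by (auto simp: coset_def)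
lemma coset_eq_iff: "lin_subspace N \<Longrightarrow> coset N x = coset N y \<longleftrightarrow> (\<lambda>i. x i - y i) \<in> N"
  unfolding coset_def by (rule coset_eq_aux)
lemma coset_self: "lin_subspace N \<Longrightarrow> x \<in> coset N x"
  unfolding coset_mem lin_subspace_def by (intro bexI[of _ "\<lambda>i. 0"]) auto

lemma subquotient_carrier: "carrier (subquotient S Z N) = coset N ` Z"
  unfolding subquotient_def quotient_module_def A_RCOSETS_def RCOSETS_def coset_def
  by (auto simp: functions_on_def r_coset_def)

lemma subquotient_zero: "\<zero>\<^bsub>subquotient S Z N\<^esub> = coset N (\<lambda>i. 0)" by (simp add: subquotient_def quotient_module_def coset_def)

lemma coset_add:
  assumes N: "lin_subspace N"
  shows "coset N x \<oplus>\<^bsub>subquotient S Z N\<^esub> coset N y = coset N (\<lambda>i. x i + y i)"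
proof -
  have *: "z \<in> coset N x \<oplus>\<^bsub>subquotient S Z N\<^esub> coset N y \<longleftrightarrow> (\<exists>u\<in>coset N x. \<exists>v\<in>coset N y. z = (\<lambda>i. u i + v i))" for z
    unfolding subquotient_def quotient_module_def set_add_def set_mult_def by (simp add: functions_on_def)
  show ?thesis
  proof (intro Set.set_eqI iffI)
    fix z assume "z \<in> coset N x \<oplus>\<^bsub>subquotient S Z N\<^esub> coset N y"
    then obtain u v where uv: "u \<in> N" "v \<in> N" "z = (\<lambda>i. (u i + x i) + (v i + y i))" by (auto simp: * coset_mem)
    show "z \<in> coset N (\<lambda>i. x i + y i)" unfolding coset_mem
      by (rule bexI[of _ "\<lambda>i. u i + v i"]) (use N uv in \<open>auto simp: lin_subspace_def algebra_simps\<close>)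
  next
    fix z assume "z \<in> coset N (\<lambda>i. x i + y i)"
    then obtain u where u: "u \<in> N" "z = (\<lambda>i. u i + (x i + y i))" by (auto simp: coset_mem)
    have "(\<lambda>i. u i + x i) \<in> coset N x" using u by (auto simp: coset_mem)
    moreover note coset_self[OF N, of y]
    moreover have "z = (\<lambda>i. (u i + x i) + y i)" using u by (auto simp: algebra_simps)
    ultimately show "z \<in> coset N x \<oplus>\<^bsub>subquotient S Z N\<^esub> coset N y" unfolding * by (intro bexI) assumption+
  qed
qed

lemma coset_smult:
  assumes N: "lin_subspace N"
  shows "a \<odot>\<^bsub>subquotient S Z N\<^esub> coset N x = coset N (\<lambda>i. a * x i)"
proof -
  have "a \<odot>\<^bsub>subquotient S Z N\<^esub> coset N x = (\<Union>u\<in>coset N x. coset N (\<lambda>i. a * u i))"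
    unfolding subquotient_def quotient_module_def by (simp add: coset_functions_on') (simp add: functions_on_def coset_def)
  moreover have "coset N (\<lambda>i. a * u i) = coset N (\<lambda>i. a * x i)" if "u \<in> coset N x" for u
    unfolding coset_eq_iff[OF N] using that N by (auto simp: lin_subspace_def algebra_simps coset_mem)
  moreover note coset_self[OF N, of x]
  ultimately show ?thesis by blast
qed

lemma module_subquotient:
  fixes N :: "('i \<Rightarrow> 'k::field) set"
  assumes N: "lin_subspace N" and Z: "lin_subspace Z" and NZ: "N \<subseteq> Z"
  shows "Module.module ring_of_type_algebra (subquotient S Z N)"
proof -
  have zz: "(\<lambda>i. 0) \<in> Z" "\<And>x y. x \<in> Z \<Longrightarrow> y \<in> Z \<Longrightarrow> (\<lambda>i. x i + y i) \<in> Z" "\<And>a x. x \<in> Z \<Longrightarrow> (\<lambda>i. a * x i) \<in> Z"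
    using Z by (auto simp: lin_subspace_def)
  note simps = subquotient_carrier coset_add[OF N] coset_smult[OF N] subquotient_zero
  show ?thesis
  proof (rule moduleI)
    show "cring (ring_of_type_algebra :: 'k ring)" by (rule cring_from_type_algebra)
    show "abelian_group (subquotient S Z N)"
    proof (rule abelian_groupI)
      fix A assume "A \<in> carrier (subquotient S Z N)"
      then obtain x where x: "x \<in> Z" "A = coset N x" by (auto simp: subquotient_carrier)
      have "coset N (\<lambda>i. (-1) * x i) \<oplus>\<^bsub>subquotient S Z N\<^esub> A = \<zero>\<^bsub>subquotient S Z N\<^esub>"
        unfolding x simps by simp
      then show "\<exists>y\<in>carrier (subquotient S Z N). y \<oplus>\<^bsub>subquotient S Z N\<^esub> A = \<zero>\<^bsub>subquotient S Z N\<^esub>"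
        unfolding subquotient_carrier using zz(3)[OF x(1), of "-1"] by fast
    qed (auto simp: simps zz add_ac)
  qed (auto simp: simps zz ring_of_type_algebra_def distrib_left distrib_right mult.assoc)
qed

lemma boundary_chain_space:
  fixes x :: "('v::linorder, 'k::field_char_0) chain"
  assumes K: "finite_simplicial_complex K" and x: "x \<in> carrier (chain_space K (Suc n))"
  shows "boundary x \<in> carrier (chain_space K n)"
proof -
  have xK: "\<sigma> \<in> K \<and> card \<sigma> = Suc (Suc n)" if "x \<sigma> \<noteq> 0" for \<sigma>
    using x that by (auto simp: chain_space_def functions_on_def)
  have "\<rho> \<in> K \<and> card \<rho> = Suc n" if nz: "boundary x \<rho> \<noteq> 0" for \<rho>
  proof -
    obtain \<sigma> where s: "x \<sigma> \<noteq> 0" "(simplex_boundary \<sigma> \<rho> :: 'k) \<noteq> 0"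
      using boundary_nonzeroD[OF nz] by blast
    then obtain v where v: "v \<in> \<sigma>" "\<rho> = \<sigma> - {v}" "\<rho> \<noteq> {}"
      using simplex_boundary_nonzeroD by blast
    have "\<sigma> \<in> K" "card \<sigma> = Suc (Suc n)" using xK s by auto
    then show ?thesis using finite_simplicial_complexD(2)[OF K] finite_simplicial_complexD(3)[OF K, of \<sigma> \<rho>] v by simp
  qed
  then show ?thesis by (auto simp: chain_space_def functions_on_def)
qed

lemma boundary_linear:
  assumes "finite S" "x \<in> carrier (chain_space S n)" "y \<in> carrier (chain_space S n)"
  shows "boundary (\<lambda>\<sigma>. x \<sigma> + y \<sigma>) = (\<lambda>\<tau>. boundary x \<tau> + boundary y \<tau>)"
    and "boundary (\<lambda>\<sigma>. a * x \<sigma>) = (\<lambda>\<tau>. a * boundary x \<tau>)"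
proof -
  have s: "x \<sigma> \<noteq> 0 \<Longrightarrow> \<sigma> \<in> S" "y \<sigma> \<noteq> 0 \<Longrightarrow> \<sigma> \<in> S" for \<sigma> using assms by (auto simp: chain_space_def functions_on_def)
  have 1: "x \<sigma> + y \<sigma> \<noteq> 0 \<Longrightarrow> \<sigma> \<in> S" "a * x \<sigma> \<noteq> 0 \<Longrightarrow> \<sigma> \<in> S" for \<sigma>
    using s[of \<sigma>] by (cases "x \<sigma> = 0"; simp)+
  note B = boundary_eq[OF assms(1)]
  show "boundary (\<lambda>\<sigma>. x \<sigma> + y \<sigma>) = (\<lambda>\<tau>. boundary x \<tau> + boundary y \<tau>)"
    using B[of x, OF s(1)] B[of y, OF s(2)] B[of "\<lambda>\<sigma>. x \<sigma> + y \<sigma>", OF 1(1)]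
    by (intro ext) (simp add: sum.distrib distrib_right)
  show "boundary (\<lambda>\<sigma>. a * x \<sigma>) = (\<lambda>\<tau>. a * boundary x \<tau>)"
    using B[of x, OF s(1)] B[of "\<lambda>\<sigma>. a * x \<sigma>", OF 1(2)]
    by (intro ext) (simp add: sum_distrib_left mult.assoc)
qed

lemma chain_space_closed:
  shows "(\<lambda>i. 0) \<in> carrier (chain_space S n)"
   "x \<in> carrier (chain_space S n) \<Longrightarrow> y \<in> carrier (chain_space S n) \<Longrightarrow> (\<lambda>i. x i + y i) \<in> carrier (chain_space S n)"
   "x \<in> carrier (chain_space S n) \<Longrightarrow> (\<lambda>i. a * x i) \<in> carrier (chain_space S n)"
proof -
  show "x \<in> carrier (chain_space S n) \<Longrightarrow> y \<in> carrier (chain_space S n) \<Longrightarrow> (\<lambda>i. x i + y i) \<in> carrier (chain_space S n)"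
    unfolding chain_space_def functions_on_def by simp (metis add.right_neutral)
qed (auto simp: chain_space_def functions_on_def)

lemma lin_subspace_cycles: fixes S :: "'v::linorder set set" assumes "finite S" shows "lin_subspace (cycles S n :: ('v,'k::field) chain set)"
proof -
  have "boundary (\<lambda>\<sigma>::'v set. 0::'k) = (\<lambda>\<tau>. 0)" by (simp add: boundary_def)
  moreover have "boundary (\<lambda>\<sigma>. x \<sigma> + y \<sigma>) = (\<lambda>\<tau>. 0)"
    if "x \<in> carrier (chain_space S n)" "boundary x = (\<lambda>\<tau>. 0)" "y \<in> carrier (chain_space S n)" "boundary y = (\<lambda>\<tau>. 0)" for x y :: "('v,'k) chain"
    using boundary_linear(1)[OF assms that(1,3)] that by simp
  moreover have "boundary (\<lambda>\<sigma>. a * x \<sigma>) = (\<lambda>\<tau>. 0)"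
    if "x \<in> carrier (chain_space S n)" "boundary x = (\<lambda>\<tau>. 0)" for a and x :: "('v,'k) chain"
    using boundary_linear(2)[OF assms that(1,1)] that by simp
  ultimately show ?thesis unfolding lin_subspace_def cycles_def
    by (simp add: chain_space_closed)
qed

lemma lin_subspace_boundaries: fixes S :: "'v::linorder set set" assumes "finite S" shows "lin_subspace (boundaries S n :: ('v,'k::field) chain set)"
proof -
  let ?B = "boundaries S n :: ('v,'k::field) chain set"
  have 0: "(\<lambda>i. 0) \<in> ?B"
    unfolding boundaries_def by (rule image_eqI[OF _ chain_space_closed(1)]) (simp add: boundary_def)
  have 1: "(\<lambda>i. x i + y i) \<in> ?B" if xy: "x \<in> ?B" "y \<in> ?B" for x y
  proof -
    from xy obtain u v where uv: "u \<in> carrier (chain_space S (Suc n))" "v \<in> carrier (chain_space S (Suc n))"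
      "x = boundary u" "y = boundary v" unfolding boundaries_def by auto
    show ?thesis unfolding boundaries_def
      by (rule image_eqI[OF _ chain_space_closed(2)[OF uv(1,2)]]) (simp add: boundary_linear(1)[OF assms uv(1,2)] uv)
  qed
  have 2: "(\<lambda>i. a * x i) \<in> ?B" if x: "x \<in> ?B" for x a
  proof -
    from x obtain u where uv: "u \<in> carrier (chain_space S (Suc n))"
      "x = boundary u" unfolding boundaries_def by auto
    show ?thesis unfolding boundaries_def
      by (rule image_eqI[OF _ chain_space_closed(3)[OF uv(1)]]) (simp add: boundary_linear(2)[OF assms uv(1) uv(1)] uv)
  qed
  show ?thesis using 0 1 2 by (auto simp: lin_subspace_def)
qed

lemma boundaries_subset_cycles:
  fixes S :: "'v::linorder set set"
  assumes "finite_simplicial_complex S"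
  shows "(boundaries S n :: ('v,'k::field_char_0) chain set) \<subseteq> cycles S n"
proof
  fix y :: "('v,'k) chain" assume "y \<in> boundaries S n"
  then obtain x :: "('v,'k) chain" where x: "x \<in> carrier (chain_space S (Suc n))" and y: "y = boundary x"
    unfolding boundaries_def by blast
  have s: "\<And>\<sigma>. x \<sigma> \<noteq> 0 \<Longrightarrow> \<sigma> \<in> S" using x by (auto simp: chain_space_def functions_on_def)
  show "y \<in> cycles S n" unfolding cycles_def y
    using boundary_chain_space[OF assms x] boundary_boundary[OF assms s] by simp
qed

lemma homology_subquotient: "homology S n = subquotient {\<sigma> \<in> S. card \<sigma> = Suc n} (cycles S n) (boundaries S n)"
  by (simp add: homology_def subquotient_def chain_space_def)

lemma homology_inclusion_coset:
  fixes M :: "('v::linorder,'k::field) chain set"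
  assumes N: "lin_subspace (boundaries T n :: ('v,'k) chain set)" and M: "lin_subspace M" "M \<subseteq> boundaries T n"
  shows "homology_inclusion T n (coset M x) = coset (boundaries T n) x"
proof -
  have "homology_inclusion T n (coset M x) = (\<Union>u\<in>coset M x. coset (boundaries T n) u)"
    by (simp add: homology_inclusion_def chain_space_def coset_functions_on coset_def)
  also have "\<dots> = (\<Union>u\<in>coset M x. coset (boundaries T n) x)"
  proof (rule SUP_cong[OF refl])
    fix u assume "u \<in> coset M x"
    then obtain y where y: "y \<in> M" "u = (\<lambda>i. y i + x i)" unfolding coset_mem by blast
    then have "(\<lambda>i. u i - x i) \<in> boundaries T n" using M(2) by auto
    then show "coset (boundaries T n) u = coset (boundaries T n) x" using coset_eq_iff[OF N] by blast
  qed
  also have "\<dots> = coset (boundaries T n) x" using coset_self[OF M(1), of x] by blast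
  finally show ?thesis .
qed

lemma finite_simplicial_complex_sublevel:
  assumes K: "finite_simplicial_complex K" and f: "filtration_function K f"
  shows "finite_simplicial_complex (sublevel K f t)"
proof -
  have "\<tau> \<in> sublevel K f t" if s: "\<sigma> \<in> sublevel K f t" "\<tau> \<subseteq> \<sigma>" "\<tau> \<noteq> {}" for \<sigma> \<tau>
  proof -
    have "\<sigma> \<in> K" "f \<sigma> \<le> t" using s by (simp_all add: sublevel_def)
    moreover have "\<tau> \<in> K" using finite_simplicial_complexD(3)[OF K \<open>\<sigma> \<in> K\<close>] s by simp
    moreover have "f \<tau> \<le> f \<sigma>" using f s \<open>\<sigma> \<in> K\<close> \<open>\<tau> \<in> K\<close> unfolding filtration_function_def by blast
    ultimately show ?thesis by (simp add: sublevel_def)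
  qed
  moreover have "finite (sublevel K f t)" using finite_simplicial_complexD(1)[OF K] by (simp add: sublevel_def)
  moreover have "finite \<sigma> \<and> \<sigma> \<noteq> {}" if "\<sigma> \<in> sublevel K f t" for \<sigma>
    using K that by (simp add: sublevel_def finite_simplicial_complex_def)
  ultimately show ?thesis unfolding finite_simplicial_complex_def by blast
qed

lemma persistence_module_homology:
  fixes K :: "'v::linorder set set"
  assumes "finite_simplicial_complex K" "filtration_function K f"
  shows "persistence_module (persistent_homology K f n :: ('k::field_char_0, ('v,'k) chain set) pmod)"
proof -
  note cx = finite_simplicial_complex_sublevel[OF assms]
  have fin: "finite (sublevel K f t)" for t using finite_simplicial_complexD(1)[OF cx] .
  note sB = lin_subspace_boundaries[OF fin] and sZ = lin_subspace_cycles[OF fin]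
  have mono: "(carrier (chain_space (sublevel K f s) m) :: ('v,'k) chain set) \<subseteq> carrier (chain_space (sublevel K f t) m)" if "s \<le> t" for s t m
    using that by (fastforce simp: chain_space_def functions_on_def sublevel_def)
  have Bm: "boundaries (sublevel K f s) n \<subseteq> (boundaries (sublevel K f t) n :: ('v,'k) chain set)" if "s \<le> t" for s t
    unfolding boundaries_def using mono[OF that] by blast
  have Zm: "cycles (sublevel K f s) n \<subseteq> (cycles (sublevel K f t) n :: ('v,'k) chain set)" if "s \<le> t" for s t
    unfolding cycles_def using mono[OF that] by blast
  note I = homology_inclusion_coset[OF sB sB Bm]
  show ?thesis
  proof (rule persistence_module.intro)
    show "Module.module ring_of_type_algebra (pspace (persistent_homology K f n :: ('k, ('v,'k) chain set) pmod) t)" for t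
      unfolding persistent_homology_def pmod.simps homology_subquotient
      by (rule module_subquotient[OF sB sZ boundaries_subset_cycles[OF cx]])
  next
    fix s t :: real assume st: "s \<le> t"
    show "pmap (persistent_homology K f n) s t \<in> linear_maps (pspace (persistent_homology K f n :: ('k, ('v,'k) chain set) pmod) s)
          (pspace (persistent_homology K f n) t)"
      unfolding persistent_homology_def pmod.simps homology_subquotient linear_maps_def subquotient_carrier
      using Zm[OF st] by (auto simp: I[OF st] coset_add[OF sB] coset_smult[OF sB])
  qed (auto simp: persistent_homology_def homology_subquotient subquotient_carrier I)
qed

lemma persistence_module_interval_sum:
  assumes "\<And>I. I \<in># B \<Longrightarrow> is_interval I"
  shows "persistence_module (interval_sum B :: ('k::field, real set \<times> nat \<Rightarrow> 'k) pmod)"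
proof (rule persistence_module.intro)
  fix r s t :: real and x :: "real set \<times> nat \<Rightarrow> 'k"
  assume rst: "r \<le> s" "s \<le> t" and x: "x \<in> carrier (pspace (interval_sum B) r)"
  have supp: "s \<in> fst b" if "x b \<noteq> 0" "t \<in> fst b" for b
  proof -
    have b: "b \<in> bars B" "r \<in> fst b" using x that by (simp_all add: interval_sum_def functions_on_def del: split_paired_All)
    then have "fst b \<in># B" by (auto simp: bars_def count_greater_zero_iff[symmetric] simp del: count_greater_zero_iff)
    then show ?thesis using assms b that rst by (meson mem_is_interval_1_I)
  qed
  have "pmap (interval_sum B) s t (pmap (interval_sum B) r s x) b = pmap (interval_sum B) r t x b" for b
    using supp[of b] by (cases "x b = 0") (simp_all add: interval_sum_def)
  then show "pmap (interval_sum B) s t (pmap (interval_sum B) r s x) = pmap (interval_sum B) r t x" ..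
next
  show "Module.module ring_of_type_algebra (pspace (interval_sum B :: ('k, real set \<times> nat \<Rightarrow> 'k) pmod) t)" for t
    unfolding interval_sum_def pmod.simps by (rule module_functions_on)
qed (auto simp: interval_sum_def functions_on_def linear_maps_def fun_eq_iff)

end

theory Submission
  imports Defs
begin

text \<open>
  If the filtrations differ by at most \<open>\<delta>\<close>, each sublevel complex of one is contained in the
  \<open>\<delta>\<close>-later sublevel complex of the other, and the inclusions interleave the homologies. For the
  barcodes, write an interleaving between sums of interval modules as two matrices of scalars.
  A product of nonzero entries \<open>p \<rightarrow> q \<rightarrow> p'\<close> with the sum of the endpoints of \<open>p\<close> at most that of
  \<open>p'\<close> forces \<open>q\<close> to be \<open>\<delta>\<close>-close to \<open>p\<close> or to \<open>p'\<close>. Hence, for any set of bars longer than \<open>2\<delta>\<close>,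
  the composite restricted to the \<open>\<delta>\<close>-close bars \<open>q\<close> is unitriangular, so there are at least as many
  of these: this is Hall's condition (the argument is due to Bjerkevik). The injections obtained for
  the two sides are glued to a single matching by the Schroeder-Bernstein construction.
\<close>

section \<open>Linear algebra and the count of close bars\<close>

text \<open>Gaussian elimination by induction on the equations: equation \<open>r\<close> is either
  trivial or is solved for an unknown \<open>p\<^sub>0\<close> with nonzero coefficient and
  substituted into the others.\<close>

lemma homogeneous_system_nontrivial_solution:
  fixes g :: "'p \<Rightarrow> 'q \<Rightarrow> 'k::field"
  assumes "finite N" "finite A" "card N < card A"
  shows "\<exists>x. (\<exists>p\<in>A. x p \<noteq> 0) \<and> (\<forall>q\<in>N. (\<Sum>p\<in>A. x p * g p q) = 0)"
  using assms
proof (induction N arbitrary: A g rule: finite_induct)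
  case empty
  then have "A \<noteq> {}" by auto
  then show ?case by (intro exI[of _ "\<lambda>_. 1"]) auto
next
  case (insert r N)
  show ?case
  proof (cases "\<forall>p\<in>A. g p r = 0")
    case True
    have "card N < card A" using insert by simp
    from insert.IH[OF insert.prems(1) this, of g] obtain x where
      x: "\<exists>p\<in>A. x p \<noteq> 0" "\<forall>q\<in>N. (\<Sum>p\<in>A. x p * g p q) = 0" by blast
    show ?thesis using x True by (intro exI[of _ x]) simp
  next
    case False
    then obtain p\<^sub>0 where p0: "p\<^sub>0 \<in> A" "g p\<^sub>0 r \<noteq> 0" by blast
    let ?A = "A - {p\<^sub>0}"
    have fin: "finite ?A" and "card N < card ?A"
      using insert.hyps insert.prems p0(1) by (simp_all add: card_Diff_singleton)
    from insert.IH[OF this, of "\<lambda>p q. g p q - g p r / g p\<^sub>0 r * g p\<^sub>0 q"] obtain x where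
      x: "\<exists>p\<in>?A. x p \<noteq> 0" "\<And>q. q \<in> N \<Longrightarrow> (\<Sum>p\<in>?A. x p * (g p q - g p r / g p\<^sub>0 r * g p\<^sub>0 q)) = 0" by blast
    \<comment> \<open>The value at \<open>p\<^sub>0\<close> is the one that equation
      \<open>r\<close> forces. For \<open>q = r\<close> all coefficients on the right of
      \<open>sum_y\<close> vanish.\<close>
    define y where "y = x(p\<^sub>0 := - (\<Sum>p\<in>?A. x p * g p r / g p\<^sub>0 r))"
    have sum_y: "(\<Sum>p\<in>A. y p * g p q) = (\<Sum>p\<in>?A. x p * (g p q - g p r / g p\<^sub>0 r * g p\<^sub>0 q))" for q
    proof -
      have "(\<Sum>p\<in>A. y p * g p q) = y p\<^sub>0 * g p\<^sub>0 q + (\<Sum>p\<in>?A. y p * g p q)"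
        using insert.prems(1) p0(1) by (rule sum.remove)
      also have "(\<Sum>p\<in>?A. y p * g p q) = (\<Sum>p\<in>?A. x p * g p q)"
        by (rule sum.cong) (auto simp: y_def)
      finally show ?thesis
        by (simp add: y_def sum_distrib_right right_diff_distrib sum_subtractf mult.assoc)
    qed
    have "(\<Sum>p\<in>A. y p * g p q) = 0" if "q \<in> insert r N" for q
      using that x(2)[of q] p0(2) by (cases "q = r") (auto simp: sum_y)
    moreover have "\<exists>p\<in>A. y p \<noteq> 0" using x(1) by (auto simp: y_def)
    ultimately show ?thesis by blast
  qed
qed

text \<open>Otherwise the rows of \<open>g\<close>, restricted to the close \<open>q\<close>,
  satisfy a nontrivial relation \<open>x\<close>. Let \<open>p'\<close> have the largest endpoint
  sum in the support of \<open>x\<close>. Pairing the relation with the column of \<open>h\<close>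
  at \<open>p'\<close> gives 0, but by triangularity it also gives \<open>x p'\<close>.\<close>

lemma card_le_card_close:
  fixes g :: "'p \<Rightarrow> 'q \<Rightarrow> 'k::field" and h :: "'q \<Rightarrow> 'p \<Rightarrow> 'k"
    and b d :: "'p \<Rightarrow> real" and b' d' :: "'q \<Rightarrow> real"
  assumes fin: "finite A" "finite Q" and "0 \<le> \<delta>"
    and g: "\<And>p q. \<lbrakk>p \<in> A; q \<in> Q; g p q \<noteq> 0\<rbrakk> \<Longrightarrow> b' q \<le> b p + \<delta> \<and> d' q \<le> d p + \<delta>"
    and h: "\<And>p q. \<lbrakk>p \<in> A; q \<in> Q; h q p \<noteq> 0\<rbrakk> \<Longrightarrow> b p \<le> b' q + \<delta> \<and> d p \<le> d' q + \<delta>"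
    and long: "\<And>p. p \<in> A \<Longrightarrow> b p + 2 * \<delta> < d p"
    and comp: "\<And>p p'. \<lbrakk>p \<in> A; p' \<in> A; b p + 2 * \<delta> < d p'; b p' < d p\<rbrakk> \<Longrightarrow>
      (\<Sum>q\<in>Q. g p q * h q p') = (if p = p' then 1 else 0)"
  shows "card A \<le> card {q \<in> Q. \<exists>p\<in>A. \<bar>b p - b' q\<bar> \<le> \<delta> \<and> \<bar>d p - d' q\<bar> \<le> \<delta>}" (is "_ \<le> card ?N")
proof (rule ccontr)
  assume "\<not> ?thesis"
  then obtain x where x: "\<exists>p\<in>A. x p \<noteq> 0" "\<And>q. q \<in> ?N \<Longrightarrow> (\<Sum>p\<in>A. x p * g p q) = 0"
    using homogeneous_system_nontrivial_solution[of ?N A g] fin by auto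
  define S where "S = {p \<in> A. x p \<noteq> 0}"
  have S: "finite S" "S \<noteq> {}" using fin x(1) by (auto simp: S_def)
  then have "Max ((\<lambda>p. b p + d p) ` S) \<in> (\<lambda>p. b p + d p) ` S" by (intro Max_in) auto
  then obtain p' where "p' \<in> S" and Max: "Max ((\<lambda>p. b p + d p) ` S) = b p' + d p'" by blast
  then have p': "p' \<in> A" "x p' \<noteq> 0" by (auto simp: S_def)
  have max: "b p + d p \<le> b p' + d p'" if "p \<in> A" "x p \<noteq> 0" for p
    unfolding Max[symmetric] using S that by (intro Max_ge) (auto simp: S_def)
  have entry: "(\<Sum>q\<in>?N. g p q * h q p') = (if p = p' then 1 else 0)" if p: "p \<in> A" "x p \<noteq> 0" for p
  proof -
    have le: "b p + d p \<le> b p' + d p'" using max p by blast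
    \<comment> \<open>If the product is nonzero and \<open>q\<close> is not close to
      \<open>p\<close>, one endpoint of \<open>q\<close> lies more than \<open>\<delta>\<close>
      below that of \<open>p\<close> and the other at most \<open>\<delta>\<close> above, so
      \<open>q\<close> has a smaller endpoint sum than \<open>p\<close>. In the same way it has a
      larger one than \<open>p'\<close>, against the choice of \<open>p'\<close>.\<close>
    have "g p q * h q p' = 0" if "q \<in> Q - ?N" for q
    proof (rule ccontr)
      assume "g p q * h q p' \<noteq> 0"
      then have "b' q \<le> b p + \<delta>" "d' q \<le> d p + \<delta>" "b p' \<le> b' q + \<delta>" "d p' \<le> d' q + \<delta>"
        using g[of p q] h[of p' q] that p p' by auto
      moreover have "\<not> (\<bar>b p - b' q\<bar> \<le> \<delta> \<and> \<bar>d p - d' q\<bar> \<le> \<delta>)"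
        "\<not> (\<bar>b p' - b' q\<bar> \<le> \<delta> \<and> \<bar>d p' - d' q\<bar> \<le> \<delta>)"
        using that p p' by auto
      ultimately show False using le \<open>0 \<le> \<delta>\<close> by linarith
    qed
    then have eq: "(\<Sum>q\<in>?N. g p q * h q p') = (\<Sum>q\<in>Q. g p q * h q p')"
      using fin by (intro sum.mono_neutral_left) auto
    show ?thesis
    proof (cases "b p' \<le> b p + 2 * \<delta>")
      case True
      \<comment> \<open>If \<open>b p \<le> b p'\<close>, the first inequality follows from the
        length of \<open>p'\<close>. Otherwise maximality gives \<open>d p < d p'\<close>, and the
        length of \<open>p\<close> suffices.\<close>
      have "b p + 2 * \<delta> < d p'" "b p' < d p"
        using True le long[of p] long[of p'] p p' \<open>0 \<le> \<delta>\<close> by linarith+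
      then show ?thesis using comp p p' eq by simp
    next
      case False
      \<comment> \<open>Here \<open>comp\<close> may not apply, but two nonzero factors would force
        \<open>b p' \<le> b p + 2 * \<delta>\<close>.\<close>
      then have "p \<noteq> p'" using \<open>0 \<le> \<delta>\<close> by auto
      moreover have "g p q * h q p' = 0" if "q \<in> Q" for q
        using g[of p q] h[of p' q] that p p' False by (cases "g p q = 0"; cases "h q p' = 0") auto
      then have "(\<Sum>q\<in>Q. g p q * h q p') = 0" by (rule sum.neutral[OF ballI])
      ultimately show ?thesis using eq by simp
    qed
  qed
  \<comment> \<open>The double sum is evaluated in both orders. \<open>entry\<close> covers the
    support of \<open>x\<close>; elsewhere the factor \<open>x p\<close> is 0.\<close>
  have "(\<Sum>p\<in>A. x p * (\<Sum>q\<in>?N. g p q * h q p')) = (\<Sum>p\<in>A. if p = p' then x p' else 0)"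
  proof (rule sum.cong[OF refl])
    fix p assume "p \<in> A"
    then show "x p * (\<Sum>q\<in>?N. g p q * h q p') = (if p = p' then x p' else 0)"
      using entry[of p] p'(2) by (cases "x p = 0") auto
  qed
  also have "\<dots> = x p'" using fin p' by simp
  also have "(\<Sum>p\<in>A. x p * (\<Sum>q\<in>?N. g p q * h q p')) = (\<Sum>q\<in>?N. (\<Sum>p\<in>A. x p * g p q) * h q p')"
    unfolding sum_distrib_left sum_distrib_right by (subst sum.swap) (simp add: mult.assoc)
  also have "\<dots> = 0" using x(2) by (intro sum.neutral) auto
  finally show False using p' by simp
qed

section \<open>Hall's theorem and the gluing of injections\<close>

text \<open>Induction on \<open>A\<close>. If some nonempty proper subset is tight, it is matched
  into its own neighbours and the rest of \<open>A\<close> outside them. If none is, every nonempty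
  proper subset has a neighbour to spare, so one element can be matched arbitrarily and its partner
  removed.\<close>

lemma hall:
  assumes "finite A" "\<And>a. a \<in> A \<Longrightarrow> finite (N a)" "\<And>S. S \<subseteq> A \<Longrightarrow> card S \<le> card (\<Union>a\<in>S. N a)"
  shows "\<exists>f. inj_on f A \<and> (\<forall>a\<in>A. f a \<in> N a)"
  using assms
proof (induction A arbitrary: N rule: finite_psubset_induct)
  case (psubset A)
  note fin = psubset.prems(1) and hall = psubset.prems(2)
  have finU: "finite (\<Union>a\<in>S. N a)" if "S \<subseteq> A" for S
    using that fin psubset.hyps finite_subset by blast
  consider "A = {}" | "\<exists>S. S \<subset> A \<and> S \<noteq> {} \<and> card (\<Union>a\<in>S. N a) = card S"
    | "A \<noteq> {}" "\<And>S. S \<subset> A \<Longrightarrow> S \<noteq> {} \<Longrightarrow> card S < card (\<Union>a\<in>S. N a)"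
    using hall by (metis le_neq_implies_less psubset_imp_subset)
  then show ?case
  proof cases
    case 1
    then show ?thesis by simp
  next
    case 2
    then obtain S where S: "S \<subset> A" "S \<noteq> {}" "card (\<Union>a\<in>S. N a) = card S" by blast
    let ?U = "\<Union>a\<in>S. N a"
    have "\<exists>f. inj_on f S \<and> (\<forall>a\<in>S. f a \<in> N a)"
      using S by (intro psubset.IH fin hall) auto
    then obtain f where f: "inj_on f S" "\<And>a. a \<in> S \<Longrightarrow> f a \<in> N a" by blast
    have "\<exists>f. inj_on f (A - S) \<and> (\<forall>a\<in>A - S. f a \<in> N a - ?U)"
    proof (rule psubset.IH)
      fix R assume R: "R \<subseteq> A - S"
      have finR: "finite R" "finite S" using R S psubset.hyps finite_subset by blast+
      \<comment> \<open>Subtracting the tight equality for \<open>S\<close> from Hall's condition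
        for \<open>S \<union> R\<close> leaves Hall's condition for \<open>R\<close> outside
        \<open>?U\<close>.\<close>
      have "card S + card R = card (S \<union> R)" using R finR by (intro card_Un_disjoint[symmetric]) auto
      also have "\<dots> \<le> card (\<Union>a\<in>S \<union> R. N a)" using R S by (intro hall) auto
      also have "(\<Union>a\<in>S \<union> R. N a) = ?U \<union> (\<Union>a\<in>R. N a - ?U)" by auto
      also have "card \<dots> \<le> card ?U + card (\<Union>a\<in>R. N a - ?U)" by (rule card_Un_le)
      finally show "card R \<le> card (\<Union>a\<in>R. N a - ?U)" using S(3) by simp
    qed (use S fin in auto)
    then obtain f' where f': "inj_on f' (A - S)" "\<And>a. a \<in> A - S \<Longrightarrow> f' a \<in> N a - ?U" by blast
    define k where "k = (\<lambda>a. if a \<in> S then f a else f' a)"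
    have "inj_on k A"
    proof (rule inj_onI)
      fix a c assume ac: "a \<in> A" "c \<in> A" "k a = k c"
      then show "a = c"
        using f(2)[of a] f(2)[of c] f'(2)[of a] f'(2)[of c] inj_onD[OF f(1), of a c] inj_onD[OF f'(1), of a c]
        by (cases "a \<in> S"; cases "c \<in> S") (auto simp: k_def)
    qed
    moreover have "\<forall>a\<in>A. k a \<in> N a" using f(2) f'(2) by (auto simp: k_def)
    ultimately show ?thesis by blast
  next
    case 3
    then obtain a where a: "a \<in> A" by blast
    have "N a \<noteq> {}" using hall[of "{a}"] a by auto
    then obtain y where y: "y \<in> N a" by blast
    have "\<exists>f. inj_on f (A - {a}) \<and> (\<forall>c\<in>A - {a}. f c \<in> N c - {y})"
    proof (rule psubset.IH)
      fix R assume R: "R \<subseteq> A - {a}"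
      show "card R \<le> card (\<Union>c\<in>R. N c - {y})"
      proof (cases "R = {}")
        case False
        \<comment> \<open>The strict inequality absorbs the loss of \<open>y\<close>.\<close>
        have "card R < card (\<Union>c\<in>R. N c)" using R a False by (intro 3(2)) auto
        also have "(\<Union>c\<in>R. N c) \<subseteq> insert y (\<Union>c\<in>R. N c - {y})" by auto
        then have "card (\<Union>c\<in>R. N c) \<le> card (insert y (\<Union>c\<in>R. N c - {y}))"
          using R finU[of R] by (intro card_mono) (auto intro: finite_subset[OF _ finU[of R]])
        also have "\<dots> \<le> Suc (card (\<Union>c\<in>R. N c - {y}))" by (rule card_insert_le_m1) auto
        finally show ?thesis by simp
      qed simp
    qed (use a fin in auto)
    then obtain f where f: "inj_on f (A - {a})" "\<And>c. c \<in> A - {a} \<Longrightarrow> f c \<in> N c - {y}" by blast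
    have "inj_on (f(a := y)) A" 
      using f unfolding inj_on_def by (metis DiffI Diff_iff fun_upd_apply insertI1 singletonD)
    moreover have "\<forall>c\<in>A. (f(a := y)) c \<in> N c" using f(2) y by auto
    ultimately show ?thesis by blast
  qed
qed

lemma glue_partial_injections:
  assumes f: "inj_on f U" and h: "inj_on h V"
  shows "\<exists>m. inj_on fst m \<and> inj_on snd m \<and> U \<subseteq> fst ` m \<and> V \<subseteq> snd ` m \<and>
    m \<subseteq> (\<lambda>x. (x, f x)) ` U \<union> (\<lambda>y. (h y, y)) ` V"
proof -
  \<comment> \<open>Two nested complements make the operator monotone, so the fixed point
    exists.\<close>
  define D where "D = lfp (\<lambda>Z. U - h ` (V - f ` Z))"
  have D: "D = U - h ` (V - f ` D)"
    unfolding D_def by (rule lfp_unfold, rule monoI) blast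
  let ?m = "(\<lambda>x. (x, f x)) ` D \<union> (\<lambda>y. (h y, y)) ` (V - f ` D)"
  have "D \<subseteq> U" using D by blast
  have "inj_on fst ?m"
  proof (rule inj_onI)
    fix u v assume uv: "u \<in> ?m" "v \<in> ?m" "fst u = fst v"
    then show "u = v" using D inj_onD[OF h, of "snd u" "snd v"] by auto
  qed
  moreover have "inj_on snd ?m"
  proof (rule inj_onI)
    fix u v assume uv: "u \<in> ?m" "v \<in> ?m" "snd u = snd v"
    then show "u = v" using subsetD[OF \<open>D \<subseteq> U\<close>, of "fst u"] subsetD[OF \<open>D \<subseteq> U\<close>, of "fst v"]
        inj_onD[OF f, of "fst u" "fst v"] by auto
  qed
  moreover have "U \<subseteq> D \<union> h ` (V - f ` D)" using D by blast
  then have "U \<subseteq> fst ` ?m" by (simp add: image_Un image_image)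
  moreover have "V \<subseteq> snd ` ?m" by (auto simp: image_Un image_image)
  moreover have "?m \<subseteq> (\<lambda>x. (x, f x)) ` U \<union> (\<lambda>y. (h y, y)) ` V" using \<open>D \<subseteq> U\<close> by blast
  ultimately show ?thesis by (intro exI[of _ ?m] conjI)
qed

section \<open>Endpoints and relative position of intervals\<close>

text \<open>Clamping at a large \<open>R\<close> makes the sum of the endpoints of an unbounded bar a real number.\<close>

definition ereal_clamp :: "real \<Rightarrow> ereal \<Rightarrow> real" where
  "ereal_clamp R x = real_of_ereal (max (- ereal R) (min (ereal R) x))"

lemma ereal_clamp_le_add:
  assumes "x \<le> y + ereal \<delta>" "0 \<le> \<delta>" "0 \<le> R"
  shows "ereal_clamp R x \<le> ereal_clamp R y + \<delta>"
  using assms unfolding ereal_clamp_def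
  by (cases x; cases y) (auto simp: max_def min_def split: if_splits)

lemma eventually_ereal_clamp_less:
  assumes "y + ereal \<delta> < x" "0 \<le> \<delta>"
  shows "\<forall>\<^sub>F R in at_top. ereal_clamp R y + \<delta> < ereal_clamp R x"
proof -
  \<comment> \<open>Infinite values count as 0 under \<open>real_of_ereal\<close>. Beyond this bound
    finite endpoints are unchanged by clamping, and infinite ones stay more than
    \<open>\<delta>\<close> away from them.\<close>
  have "\<forall>\<^sub>F R in at_top. \<bar>real_of_ereal x\<bar> + \<bar>real_of_ereal y\<bar> + \<delta> + 1 < R" 
    by (rule eventually_gt_at_top)
  then show ?thesis
  proof eventually_elim
    case (elim R)
    then show ?case using assms unfolding ereal_clamp_def
      by (cases x; cases y) (auto simp: max_def min_def split: if_splits)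
  qed
qed

text \<open>For intervals this is the condition for a nonzero morphism from the interval module of
  \<open>I\<close> to that of \<open>J\<close> shifted by \<open>\<delta>\<close>: the shifted
  \<open>J\<close> meets \<open>I\<close>, starts no later and ends no later. Stating it by
  membership avoids a case distinction on open and closed ends.\<close>

definition overlaps :: "real \<Rightarrow> real set \<Rightarrow> real set \<Rightarrow> bool" where
  "overlaps \<delta> I J \<longleftrightarrow>
     (\<exists>s\<in>I. s + \<delta> \<in> J \<and> (\<forall>t\<ge>s. t + \<delta> \<in> J \<longrightarrow> t \<in> I) \<and> (\<forall>r\<le>s. r \<in> I \<longrightarrow> r + \<delta> \<in> J))"

lemma overlaps_birth_death:
  assumes "overlaps \<delta> I J"
  shows "birth J \<le> birth I + ereal \<delta>" "death J \<le> death I + ereal \<delta>"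
proof -
  obtain s where s: "s \<in> I" "s + \<delta> \<in> J" "\<And>t. s \<le> t \<Longrightarrow> t + \<delta> \<in> J \<Longrightarrow> t \<in> I"
    "\<And>r. r \<le> s \<Longrightarrow> r \<in> I \<Longrightarrow> r + \<delta> \<in> J"
    using assms unfolding overlaps_def by blast
  have "birth J - ereal \<delta> \<le> ereal r" if "r \<in> I" for r
  proof -
    \<comment> \<open>A point \<open>r\<close> to the right of \<open>s\<close> need not have its
      shift in \<open>J\<close>; then \<open>s\<close> serves in its place.\<close>
    have "birth J \<le> ereal (min r s + \<delta>)"
      unfolding birth_def using s(2) s(4)[of r] that by (intro Inf_lower imageI) (simp add: min_def)
    also have "\<dots> \<le> ereal (r + \<delta>)" by simp
    finally show ?thesis by (simp add: ereal_minus_le)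
  qed
  then have "birth J - ereal \<delta> \<le> birth I" unfolding birth_def[of I] by (intro Inf_greatest) auto
  then show "birth J \<le> birth I + ereal \<delta>" by (simp add: ereal_minus_le)
  have "ereal u \<le> death I + ereal \<delta>" if "u \<in> J" for u
  proof -
    have "max (u - \<delta>) s \<in> I" using s(1) s(3)[of "u - \<delta>"] that by (simp add: max_def)
    then have "ereal (max (u - \<delta>) s) \<le> death I" unfolding death_def by (intro Sup_upper imageI)
    moreover have "ereal u - ereal \<delta> \<le> ereal (max (u - \<delta>) s)" by simp
    ultimately have "ereal u - ereal \<delta> \<le> death I" by (rule order_trans[rotated])
    then show ?thesis using ereal_minus_le[of "ereal \<delta>" "ereal u" "death I"] by (simp del: ereal_minus)
  qed
  then show "death J \<le> death I + ereal \<delta>" unfolding death_def[of J] by (intro Sup_least) auto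
qed

text \<open>Ensures that a bar through which a composite entry passes is alive at the intermediate
  time. To the left of the first witness and to the right of the second one, membership is part of
  \<open>overlaps\<close>; between them it is convexity of \<open>J\<close>.\<close>

lemma overlaps_between:
  assumes "overlaps \<delta> I J" "overlaps \<delta> J I'" "is_interval J" "t \<in> I" "t + 2 * \<delta> \<in> I'"
  shows "t + \<delta> \<in> J"
proof -
  obtain s where s: "s + \<delta> \<in> J" "\<And>r. r \<le> s \<Longrightarrow> r \<in> I \<Longrightarrow> r + \<delta> \<in> J"
    using assms(1) unfolding overlaps_def by blast
  obtain u where u: "u \<in> J" "\<And>v. u \<le> v \<Longrightarrow> v + \<delta> \<in> I' \<Longrightarrow> v \<in> J"
    using assms(2) unfolding overlaps_def by blast
  consider "t \<le> s" | "u \<le> t + \<delta>" | "s + \<delta> \<le> t + \<delta>" "t + \<delta> \<le> u" by linarith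
  then show ?thesis
  proof cases
    case 2
    then show ?thesis using u(2)[of "t + \<delta>"] assms(5) by (simp add: algebra_simps)
  next
    case 3
    then show ?thesis using mem_is_interval_1_I[OF assms(3) s(1) u(1)] by blast
  qed (use s assms in auto)
qed

text \<open>The hypotheses yield \<open>x, x'\<close> in \<open>I\<close> and \<open>y, y'\<close>
  in \<open>J\<close> with \<open>x + \<epsilon> < y\<close> and
  \<open>y' < x' + \<epsilon>\<close>. By convexity the larger of \<open>x + \<epsilon>\<close> and
  \<open>y'\<close> lies in both \<open>J\<close> and the shifted \<open>I\<close>.\<close>

lemma intervals_meet_shifted:
  assumes "is_interval I" "is_interval J" "birth I + ereal \<epsilon> < death J" "birth J < death I + ereal \<epsilon>"
  shows "\<exists>t\<in>I. t + \<epsilon> \<in> J"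
proof -
  from assms(3) have "birth I < death J - ereal \<epsilon>" by (simp add: ereal_less_minus)
  then obtain x where x: "x \<in> I" "ereal x < death J - ereal \<epsilon>"
    unfolding birth_def by (auto simp: Inf_less_iff)
  then have "ereal (x + \<epsilon>) < death J" by (simp add: ereal_less_minus)
  then obtain y where y: "y \<in> J" "x + \<epsilon> < y" unfolding death_def by (auto simp: less_Sup_iff)
  from assms(4) have "birth J - ereal \<epsilon> < death I" by (simp add: ereal_minus_less)
  then obtain x' where x': "x' \<in> I" "birth J - ereal \<epsilon> < ereal x'" unfolding death_def by (auto simp: less_Sup_iff)
  then have "birth J < ereal (x' + \<epsilon>)" by (simp add: ereal_minus_less)
  then obtain y' where y': "y' \<in> J" "y' < x' + \<epsilon>" unfolding birth_def by (auto simp: Inf_less_iff)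
  show ?thesis
  proof (cases "x + \<epsilon> \<le> y'")
    case True
    have "y' - \<epsilon> \<in> I" using mem_is_interval_1_I[OF assms(1) x(1) x'(1), of "y' - \<epsilon>"] True y' by simp
    then show ?thesis using y' by (intro bexI[of _ "y' - \<epsilon>"]) auto
  next
    case False
    then have "x + \<epsilon> \<in> J" using mem_is_interval_1_I[OF assms(2) y'(1) y(1), of "x + \<epsilon>"] y by simp
    then show ?thesis using x by blast
  qed
qed

section \<open>Morphisms of interval sums as matrices\<close>

definition unit_vector :: "'i \<Rightarrow> 'i \<Rightarrow> 'k::field" where
  "unit_vector i = (\<lambda>j. if j = i then 1 else 0)"

lemma linear_maps_functions_on_expand:
  assumes L: "L \<in> linear_maps (functions_on S) (functions_on T :: ('k::field, 'j \<Rightarrow> 'k) module)"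
    and S: "finite S" and x: "x \<in> carrier (functions_on S)"
  shows "L x = (\<lambda>j. \<Sum>i\<in>S. x i * L (unit_vector i) j)"
proof -
  have add: "L (\<lambda>i. u i + v i) = (\<lambda>j. L u j + L v j)"
    if "u \<in> carrier (functions_on S)" "v \<in> carrier (functions_on S)" for u v
    using L that by (auto simp: linear_maps_def functions_on_def)
  have smult: "L (\<lambda>i. a * u i) = (\<lambda>j. a * L u j)" if "u \<in> carrier (functions_on S)" for a u
    using L that by (auto simp: linear_maps_def functions_on_def)
  \<comment> \<open>Induction over the truncations of \<open>x\<close> to finite \<open>F\<close>,
    adding one coordinate at a time.\<close>
  have "F \<subseteq> S \<Longrightarrow> L (\<lambda>i. if i \<in> F then x i else 0) = (\<lambda>j. \<Sum>i\<in>F. x i * L (unit_vector i) j)"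
    if "finite F" for F
    using that
  proof (induction F rule: finite_induct)
    case empty
    then show ?case using smult[of "\<lambda>_. 0" 0] by (simp add: functions_on_def)
  next
    case (insert i F)
    have i: "unit_vector i \<in> carrier (functions_on S)"
      and F: "(\<lambda>k. if k \<in> F then x k else 0) \<in> carrier (functions_on S)"
      and xi: "(\<lambda>k. x i * unit_vector i k) \<in> carrier (functions_on S)"
      using insert by (auto simp: unit_vector_def functions_on_def)
    have "(\<lambda>k. if k \<in> insert i F then x k else 0) =
      (\<lambda>k. x i * unit_vector i k + (if k \<in> F then x k else 0))"
      using insert by (auto simp: unit_vector_def fun_eq_iff)
    then show ?case using insert add[OF xi F] smult[OF i, of "x i"] by simp
  qed
  from this[OF S order_refl] have "L (\<lambda>i. if i \<in> S then x i else 0) = (\<lambda>j. \<Sum>i\<in>S. x i * L (unit_vector i) j)" .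
  moreover have "(\<lambda>i. if i \<in> S then x i else 0) = x" using x by (auto simp: functions_on_def fun_eq_iff)
  ultimately show ?thesis by simp
qed

lemma finite_bars: "finite (bars B)"
proof -
  have "bars B = Sigma (set_mset B) (\<lambda>I. {..<count B I})"
    by (auto simp: bars_def count_greater_zero_iff[symmetric] simp del: count_greater_zero_iff)
  then show ?thesis by simp
qed

lemma bars_memD: "p \<in> bars B \<Longrightarrow> fst p \<in># B"
  by (auto simp: bars_def count_greater_zero_iff[symmetric] simp del: count_greater_zero_iff)

text \<open>Naturality makes each matrix entry independent of the time.\<close>

lemma interval_sum_morphism_coefficients:
  fixes g :: "real \<Rightarrow> (real set \<times> nat \<Rightarrow> 'k::field) \<Rightarrow> (real set \<times> nat \<Rightarrow> 'k)"
  assumes g: "shift_morphism \<delta> (interval_sum B) (interval_sum B') g"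
  shows "\<exists>c. (\<forall>p\<in>bars B. \<forall>q\<in>bars B'. \<forall>t\<in>fst p. t + \<delta> \<in> fst q \<longrightarrow> g t (unit_vector p) q = c p q) \<and>
    (\<forall>p\<in>bars B. \<forall>q\<in>bars B'. c p q \<noteq> 0 \<longrightarrow> overlaps \<delta> (fst p) (fst q))"
proof -
  have lin: "g t \<in> linear_maps (functions_on {b \<in> bars B. t \<in> fst b}) (functions_on {b \<in> bars B'. t + \<delta> \<in> fst b})" for t
    using g by (simp add: shift_morphism_def interval_sum_def)
  have zero: "g t (\<lambda>_. 0) = (\<lambda>_. 0)" for t
    using linear_maps_functions_on_expand[OF lin, where x = "\<lambda>_. 0"] finite_bars by (simp add: functions_on_def)
  have supp: "t + \<delta> \<in> fst q" if "p \<in> bars B" "t \<in> fst p" "g t (unit_vector p) q \<noteq> 0" for t p q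
  proof -
    have "unit_vector p \<in> carrier (functions_on {b \<in> bars B. t \<in> fst b} :: ('k, real set \<times> nat \<Rightarrow> 'k) module)"
      using that by (auto simp: functions_on_def unit_vector_def)
    then have "g t (unit_vector p) \<in> carrier (functions_on {b \<in> bars B'. t + \<delta> \<in> fst b})"
      using lin[of t] by (auto simp: linear_maps_def)
    then show ?thesis using that(3) by (simp add: functions_on_def del: split_paired_All)
  qed
  \<comment> \<open>Naturality on a basis vector alive at \<open>s\<close>: the structure map keeps
    it or kills it, which gives \<open>alive\<close> and \<open>dead\<close>.\<close>
  have nat: "g t (\<lambda>b. if t \<in> fst b then unit_vector p b else 0) q = (if t + \<delta> \<in> fst q then g s (unit_vector p) q else 0)"
    if "s \<le> t" "p \<in> bars B" "s \<in> fst p" for s t p q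
  proof -
    have "unit_vector p \<in> carrier (functions_on {b \<in> bars B. s \<in> fst b} :: ('k, real set \<times> nat \<Rightarrow> 'k) module)"
      using that by (auto simp: functions_on_def unit_vector_def)
    then show ?thesis using g that by (simp add: shift_morphism_def interval_sum_def)
  qed
  have alive: "g t (unit_vector p) q = (if t + \<delta> \<in> fst q then g s (unit_vector p) q else 0)"
    if "s \<le> t" "p \<in> bars B" "s \<in> fst p" "t \<in> fst p" for s t p q
  proof -
    have "(\<lambda>b. if t \<in> fst b then unit_vector p b else (0::'k)) = unit_vector p"
      using that by (auto simp: unit_vector_def fun_eq_iff)
    then show ?thesis using nat[OF that(1-3), of q] by simp
  qed
  have dead: "g s (unit_vector p) q = 0"
    if "s \<le> t" "p \<in> bars B" "s \<in> fst p" "t \<notin> fst p" "t + \<delta> \<in> fst q" for s t p q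
  proof -
    have "(\<lambda>b. if t \<in> fst b then unit_vector p b else (0::'k)) = (\<lambda>_. 0)"
      using that by (auto simp: unit_vector_def fun_eq_iff)
    then show ?thesis using nat[OF that(1-3), of q] that by (simp add: zero)
  qed
  \<comment> \<open>Any common time gives the same entry by \<open>alive\<close>. The default 0
    ensures that a nonzero entry has a common time.\<close>
  define c where "c p q = (if \<exists>t\<in>fst p. t + \<delta> \<in> fst q
    then g (SOME t. t \<in> fst p \<and> t + \<delta> \<in> fst q) (unit_vector p) q else 0)" for p q
  have c: "g t (unit_vector p) q = c p q" if "p \<in> bars B" "t \<in> fst p" "t + \<delta> \<in> fst q" for p q t
  proof -
    define s where "s = (SOME t. t \<in> fst p \<and> t + \<delta> \<in> fst q)"
    have s: "s \<in> fst p \<and> s + \<delta> \<in> fst q" unfolding s_def by (rule someI[of _ t]) (use that in simp)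
    have "c p q = g s (unit_vector p) q" unfolding c_def s_def using that by auto
    also have "\<dots> = g t (unit_vector p) q"
    proof (cases "s \<le> t")
      case True
      then show ?thesis using alive[of s t p q] s that by simp
    next
      case False
      then show ?thesis using alive[of t s p q] s that by simp
    qed
    finally show ?thesis ..
  qed
  have "overlaps \<delta> (fst p) (fst q)" if "p \<in> bars B" "c p q \<noteq> 0" for p q
  proof -
    have "\<exists>s\<in>fst p. s + \<delta> \<in> fst q" using that(2) unfolding c_def by meson
    then obtain s where s: "s \<in> fst p" "s + \<delta> \<in> fst q" by blast
    then have nz: "g s (unit_vector p) q \<noteq> 0" using c that by simp
    \<comment> \<open>If \<open>p\<close> died while \<open>q\<close> was still alive,
      \<open>dead\<close> would make the entry zero. If \<open>q\<close> were born after
      \<open>p\<close>, the entry at the earlier time would vanish, and \<open>alive\<close> would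
      carry this zero to \<open>s\<close>.\<close>
    have "t \<in> fst p" if "s \<le> t" "t + \<delta> \<in> fst q" for t
      using dead[OF that(1) \<open>p \<in> bars B\<close> s(1) _ that(2)] nz by blast
    moreover have "r + \<delta> \<in> fst q" if "r \<le> s" "r \<in> fst p" for r
      using alive[OF that(1) \<open>p \<in> bars B\<close> that(2) s(1)] s nz supp[OF \<open>p \<in> bars B\<close> that(2)] by simp
    ultimately show ?thesis unfolding overlaps_def using s by blast
  qed
  then show ?thesis using c by (intro exI[of _ c]) auto
qed

lemma shift_morphism_comp:
  assumes f: "shift_morphism a M N f" and g: "shift_morphism b N L g"
  shows "shift_morphism (a + b) M L (\<lambda>t x. g (t + a) (f t x))"
proof -
  have fc: "f t x \<in> carrier (pspace N (t + a))" if "x \<in> carrier (pspace M t)" for t x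
    using f that by (auto simp: shift_morphism_def linear_maps_def)
  have gl: "g (t + a) \<in> linear_maps (pspace N (t + a)) (pspace L (t + (a + b)))" for t
    using g unfolding shift_morphism_def by (metis add.assoc)
  have "(\<lambda>x. g (t + a) (f t x)) \<in> linear_maps (pspace M t) (pspace L (t + (a + b)))" for t
    using f gl[of t] fc[of _ t] unfolding shift_morphism_def linear_maps_def by (auto simp: Pi_iff)
  moreover have "g (t + a) (f t (pmap M s t x)) = pmap L (s + (a + b)) (t + (a + b)) (g (s + a) (f s x))"
    if "s \<le> t" "x \<in> carrier (pspace M s)" for s t x
    using f g that fc[OF that(2)] unfolding shift_morphism_def by (simp add: add.assoc)
  ultimately show ?thesis unfolding shift_morphism_def by blast
qed

section \<open>From an interleaving of interval sums to a matching\<close>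

text \<open>Clamping can bring distant endpoints together, but a strict gap reappears for large
  \<open>R\<close>.\<close>

lemma eventually_ereal_clamp_leD:
  assumes "0 \<le> \<delta>"
  shows "\<forall>\<^sub>F R in at_top. ereal_clamp R x \<le> ereal_clamp R y + \<delta> \<longrightarrow> x \<le> y + ereal \<delta>"
proof (cases "x \<le> y + ereal \<delta>")
  case False
  then have "y + ereal \<delta> < x" by simp
  from eventually_ereal_clamp_less[OF this assms] show ?thesis by (rule eventually_mono) auto
qed simp

definition endpoints_close :: "real \<Rightarrow> real set \<Rightarrow> real set \<Rightarrow> bool" where
  "endpoints_close \<delta> I J \<longleftrightarrow>
     birth I \<le> birth J + ereal \<delta> \<and> birth J \<le> birth I + ereal \<delta> \<and>
     death I \<le> death J + ereal \<delta> \<and> death J \<le> death I + ereal \<delta>"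

text \<open>For \<open>\<epsilon> = 2 * \<delta>\<close> these are the bars that a
  \<open>\<delta>\<close>-matching must cover.\<close>

definition long_bars :: "real \<Rightarrow> real set multiset \<Rightarrow> (real set \<times> nat) set" where
  "long_bars \<epsilon> B = {p \<in> bars B. birth (fst p) + ereal \<epsilon> < death (fst p)}"

text \<open>The third property reads the equation between the composite and the structure map of
  \<open>B\<close> as a matrix identity. The entry for \<open>p\<close> and \<open>p'\<close> is
  visible at a time \<open>t\<close> with \<open>p\<close> alive at \<open>t\<close> and
  \<open>p'\<close> alive at \<open>t + 2 * \<delta>\<close>; the endpoint conditions provide such a
  \<open>t\<close>.\<close>

lemma interleaved_interval_sum_coefficients:
  assumes "interleaved \<delta> (interval_sum B :: ('k::field, _) pmod) (interval_sum B')"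
    and B: "\<And>I. I \<in># B \<Longrightarrow> is_interval I" and B': "\<And>J. J \<in># B' \<Longrightarrow> is_interval J"
  obtains c :: "real set \<times> nat \<Rightarrow> real set \<times> nat \<Rightarrow> 'k::field" and d where
    "\<And>p q. \<lbrakk>p \<in> bars B; q \<in> bars B'; c p q \<noteq> 0\<rbrakk> \<Longrightarrow> overlaps \<delta> (fst p) (fst q)"
    "\<And>p q. \<lbrakk>p \<in> bars B; q \<in> bars B'; d q p \<noteq> 0\<rbrakk> \<Longrightarrow> overlaps \<delta> (fst q) (fst p)"
    "\<And>p p'. \<lbrakk>p \<in> bars B; p' \<in> bars B; birth (fst p) + ereal (2 * \<delta>) < death (fst p');
      birth (fst p') < death (fst p) + ereal (2 * \<delta>)\<rbrakk> \<Longrightarrow>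
      (\<Sum>q\<in>bars B'. c p q * d q p') = (if p = p' then 1 else 0)"
proof -
  obtain g h :: "real \<Rightarrow> (real set \<times> nat \<Rightarrow> 'k) \<Rightarrow> _" where
    g: "shift_morphism \<delta> (interval_sum B) (interval_sum B') g"
    and h: "shift_morphism \<delta> (interval_sum B') (interval_sum B) h"
    and hg: "\<And>t x. x \<in> carrier (pspace (interval_sum B) t) \<Longrightarrow>
      h (t + \<delta>) (g t x) = pmap (interval_sum B) t (t + 2 * \<delta>) x"
    using assms(1) unfolding interleaved_def by blast
  obtain c where c: "\<And>p q t. \<lbrakk>p \<in> bars B; q \<in> bars B'; t \<in> fst p; t + \<delta> \<in> fst q\<rbrakk> \<Longrightarrow> g t (unit_vector p) q = c p q"
    "\<And>p q. \<lbrakk>p \<in> bars B; q \<in> bars B'; c p q \<noteq> 0\<rbrakk> \<Longrightarrow> overlaps \<delta> (fst p) (fst q)"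
    using interval_sum_morphism_coefficients[OF g] by metis
  obtain d where d: "\<And>q p t. \<lbrakk>q \<in> bars B'; p \<in> bars B; t \<in> fst q; t + \<delta> \<in> fst p\<rbrakk> \<Longrightarrow> h t (unit_vector q) p = d q p"
    "\<And>q p. \<lbrakk>q \<in> bars B'; p \<in> bars B; d q p \<noteq> 0\<rbrakk> \<Longrightarrow> overlaps \<delta> (fst q) (fst p)"
    using interval_sum_morphism_coefficients[OF h] by metis
  have cd: "(\<Sum>q\<in>bars B'. c p q * d q p') = (if p = p' then 1 else 0)"
    if p: "p \<in> bars B" "p' \<in> bars B" and meet: "birth (fst p) + ereal (2 * \<delta>) < death (fst p')"
      "birth (fst p') < death (fst p) + ereal (2 * \<delta>)" for p p'
  proof -
    obtain t where t: "t \<in> fst p" "t + 2 * \<delta> \<in> fst p'"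
      using intervals_meet_shifted[OF B[OF bars_memD[OF p(1)]] B[OF bars_memD[OF p(2)]] meet] by blast
    have t': "t + \<delta> + \<delta> \<in> fst p'" using t by (simp add: algebra_simps)
    let ?S = "{q \<in> bars B'. t + \<delta> \<in> fst q}"
    have u: "unit_vector p \<in> carrier (functions_on {b \<in> bars B. t \<in> fst b} :: ('k, _) module)"
      using p t by (simp add: functions_on_def unit_vector_def del: split_paired_All)
    have gu: "g t (unit_vector p) \<in> carrier (functions_on ?S)"
      using g u by (auto simp: shift_morphism_def interval_sum_def linear_maps_def)
    have hl: "h (t + \<delta>) \<in> linear_maps (functions_on ?S) (functions_on {b \<in> bars B. t + \<delta> + \<delta> \<in> fst b})"
      using h unfolding shift_morphism_def interval_sum_def pmod.simps by blast
    \<comment> \<open>Bars dead at \<open>t + \<delta>\<close> contribute nothing, so the sum over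
      all bars is the matrix product at time \<open>t\<close>.\<close>
    have "c p q * d q p' = 0" if "q \<in> bars B' - ?S" for q
    proof (rule ccontr)
      assume "c p q * d q p' \<noteq> 0"
      then have "overlaps \<delta> (fst p) (fst q)" "overlaps \<delta> (fst q) (fst p')"
        using c(2)[of p q] d(2)[of q p'] that p by auto
      moreover have "is_interval (fst q)" using B' bars_memD that by blast
      ultimately show False using overlaps_between[OF _ _ _ t] that by blast
    qed
    then have "(\<Sum>q\<in>bars B'. c p q * d q p') = (\<Sum>q\<in>?S. c p q * d q p')"
      using finite_bars by (intro sum.mono_neutral_right) auto
    also have "\<dots> = (\<Sum>q\<in>?S. g t (unit_vector p) q * h (t + \<delta>) (unit_vector q) p')"
      using c(1)[OF p(1) _ t(1)] d(1)[OF _ p(2) _ t'] by (intro sum.cong) auto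
    also have "\<dots> = h (t + \<delta>) (g t (unit_vector p)) p'"
      using linear_maps_functions_on_expand[OF hl _ gu] finite_bars by simp
    also have "\<dots> = (if p = p' then 1 else 0)"
      using hg[of "unit_vector p" t] u t(2) by (simp add: interval_sum_def unit_vector_def)
    finally show ?thesis .
  qed
  show thesis by (rule that[OF c(2) d(2) cd])
qed

text \<open>Hall's theorem with the close bars as neighbours; its condition is
  \<open>card_le_card_close\<close> for endpoints clamped at a common \<open>R\<close>.\<close>

lemma interleaved_interval_sum_injection:
  assumes int: "interleaved \<delta> (interval_sum B :: ('k::field, _) pmod) (interval_sum B')"
    and B: "\<And>I. I \<in># B \<Longrightarrow> is_interval I" and B': "\<And>J. J \<in># B' \<Longrightarrow> is_interval J"
  shows "\<exists>f. inj_on f (long_bars (2 * \<delta>) B) \<and>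
    (\<forall>p\<in>long_bars (2 * \<delta>) B. f p \<in> bars B' \<and> endpoints_close \<delta> (fst p) (fst (f p)))"
proof -
  have \<delta>: "0 \<le> \<delta>" using int by (simp add: interleaved_def)
  show ?thesis
  proof (rule interleaved_interval_sum_coefficients[OF int B B'])
    fix c d :: "real set \<times> nat \<Rightarrow> real set \<times> nat \<Rightarrow> 'k"
    assume c: "\<And>p q. \<lbrakk>p \<in> bars B; q \<in> bars B'; c p q \<noteq> 0\<rbrakk> \<Longrightarrow> overlaps \<delta> (fst p) (fst q)"
      and d: "\<And>p q. \<lbrakk>p \<in> bars B; q \<in> bars B'; d q p \<noteq> 0\<rbrakk> \<Longrightarrow> overlaps \<delta> (fst q) (fst p)"
      and cd: "\<And>p p'. \<lbrakk>p \<in> bars B; p' \<in> bars B; birth (fst p) + ereal (2 * \<delta>) < death (fst p');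
        birth (fst p') < death (fst p) + ereal (2 * \<delta>)\<rbrakk> \<Longrightarrow>
        (\<Sum>q\<in>bars B'. c p q * d q p') = (if p = p' then 1 else 0)"
    let ?A = "long_bars (2 * \<delta>) B"
    let ?N = "\<lambda>p. {q \<in> bars B'. endpoints_close \<delta> (fst p) (fst q)}"
    have A: "?A \<subseteq> bars B" by (auto simp: long_bars_def)
    have finA: "finite ?A" using A finite_bars finite_subset by blast
    let ?b = "\<lambda>R p. ereal_clamp R (birth (fst p))" and ?d = "\<lambda>R p. ereal_clamp R (death (fst p))"
    \<comment> \<open>There are finitely many pairs of bars, so one \<open>R\<close> serves all of
      them.\<close>
    have "\<forall>\<^sub>F R in at_top. \<forall>p\<in>?A. \<forall>q\<in>bars B'.
      \<bar>?b R p - ?b R q\<bar> \<le> \<delta> \<and> \<bar>?d R p - ?d R q\<bar> \<le> \<delta> \<longrightarrow> endpoints_close \<delta> (fst p) (fst q)"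
    proof (intro eventually_ball_finite finA finite_bars ballI)
      fix p q :: "real set \<times> nat"
      show "\<forall>\<^sub>F R in at_top. \<bar>?b R p - ?b R q\<bar> \<le> \<delta> \<and> \<bar>?d R p - ?d R q\<bar> \<le> \<delta> \<longrightarrow> endpoints_close \<delta> (fst p) (fst q)"
        using eventually_ereal_clamp_leD[OF \<delta>, of "birth (fst p)" "birth (fst q)"]
          eventually_ereal_clamp_leD[OF \<delta>, of "birth (fst q)" "birth (fst p)"]
          eventually_ereal_clamp_leD[OF \<delta>, of "death (fst p)" "death (fst q)"]
          eventually_ereal_clamp_leD[OF \<delta>, of "death (fst q)" "death (fst p)"]
        by eventually_elim (unfold endpoints_close_def, linarith)
    qed
    moreover have "\<forall>\<^sub>F R in at_top. \<forall>p\<in>?A. ?b R p + 2 * \<delta> < ?d R p"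
      using \<delta> by (intro eventually_ball_finite finA ballI eventually_ereal_clamp_less) (auto simp: long_bars_def)
    moreover have "\<forall>\<^sub>F R in at_top. (0::real) \<le> R" by (rule eventually_ge_at_top)
    ultimately have "\<forall>\<^sub>F R in at_top. (\<forall>p\<in>?A. \<forall>q\<in>bars B'.
        \<bar>?b R p - ?b R q\<bar> \<le> \<delta> \<and> \<bar>?d R p - ?d R q\<bar> \<le> \<delta> \<longrightarrow> endpoints_close \<delta> (fst p) (fst q)) \<and>
        (\<forall>p\<in>?A. ?b R p + 2 * \<delta> < ?d R p) \<and> 0 \<le> R"
      by eventually_elim blast
    from eventually_happens'[OF _ this] obtain R where
      close: "\<And>p q. \<lbrakk>p \<in> ?A; q \<in> bars B'; \<bar>?b R p - ?b R q\<bar> \<le> \<delta>; \<bar>?d R p - ?d R q\<bar> \<le> \<delta>\<rbrakk> \<Longrightarrow>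
        endpoints_close \<delta> (fst p) (fst q)"
      and long: "\<And>p. p \<in> ?A \<Longrightarrow> ?b R p + 2 * \<delta> < ?d R p" and R: "0 \<le> R"
      by auto
    have "\<exists>f. inj_on f ?A \<and> (\<forall>p\<in>?A. f p \<in> ?N p)"
    proof (rule hall[OF finA])
      fix S assume S: "S \<subseteq> ?A"
      have "card S \<le> card {q \<in> bars B'. \<exists>p\<in>S. \<bar>?b R p - ?b R q\<bar> \<le> \<delta> \<and> \<bar>?d R p - ?d R q\<bar> \<le> \<delta>}"
      proof (rule card_le_card_close[where g = c and h = d])
        show "finite S" using S finA finite_subset by blast
        show "?b R q \<le> ?b R p + \<delta> \<and> ?d R q \<le> ?d R p + \<delta>"
          if "p \<in> S" "q \<in> bars B'" "c p q \<noteq> 0" for p q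
          using overlaps_birth_death[OF c] that S A \<delta> R by (blast intro: ereal_clamp_le_add)
        show "?b R p \<le> ?b R q + \<delta> \<and> ?d R p \<le> ?d R q + \<delta>"
          if "p \<in> S" "q \<in> bars B'" "d q p \<noteq> 0" for p q
          using overlaps_birth_death[OF d] that S A \<delta> R by (blast intro: ereal_clamp_le_add)
        show "(\<Sum>q\<in>bars B'. c p q * d q p') = (if p = p' then 1 else 0)"
          if "p \<in> S" "p' \<in> S" "?b R p + 2 * \<delta> < ?d R p'" "?b R p' < ?d R p" for p p'
        \<comment> \<open>By contraposition of \<open>ereal_clamp_le_add\<close>, strict
          inequalities between clamped endpoints hold for the true ones; the second use has shift
          0.\<close>
        proof (rule cd)
          show "birth (fst p) + ereal (2 * \<delta>) < death (fst p')"
            using ereal_clamp_le_add[of "death (fst p')" "birth (fst p)" "2 * \<delta>" R] that(3) \<delta> R by force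
          have "birth (fst p') < death (fst p)"
            using ereal_clamp_le_add[of "death (fst p)" "birth (fst p')" 0 R] that(4) R by force
          also have "\<dots> \<le> death (fst p) + ereal (2 * \<delta>)" using \<delta> by (simp add: ereal_le_add_self)
          finally show "birth (fst p') < death (fst p) + ereal (2 * \<delta>)" .
        qed (use that S A in auto)
      qed (use \<delta> finite_bars long S in auto)
      also have "\<dots> \<le> card (\<Union>p\<in>S. ?N p)"
      proof (rule card_mono)
        show "finite (\<Union>p\<in>S. ?N p)" using finite_subset[OF S finA] finite_bars by simp
        show "{q \<in> bars B'. \<exists>p\<in>S. \<bar>?b R p - ?b R q\<bar> \<le> \<delta> \<and> \<bar>?d R p - ?d R q\<bar> \<le> \<delta>} \<subseteq> (\<Union>p\<in>S. ?N p)"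
          using close S by blast
      qed
      finally show "card S \<le> card (\<Union>p\<in>S. ?N p)" .
    qed (simp add: finite_bars)
    then show ?thesis by blast
  qed
qed

lemma interleaved_sym: "interleaved \<delta> M N \<Longrightarrow> interleaved \<delta> N M"
  unfolding interleaved_def by blast

lemma interleaved_interval_sum_matching:
  assumes int: "interleaved \<delta> (interval_sum B :: ('k::field, _) pmod) (interval_sum B')"
    and B: "\<And>I. I \<in># B \<Longrightarrow> is_interval I" and B': "\<And>J. J \<in># B' \<Longrightarrow> is_interval J"
  shows "\<exists>m. matching \<delta> B B' m"
proof -
  let ?P = "long_bars (2 * \<delta>) B" and ?Q = "long_bars (2 * \<delta>) B'"
  obtain f where f: "inj_on f ?P" "\<And>p. p \<in> ?P \<Longrightarrow> f p \<in> bars B' \<and> endpoints_close \<delta> (fst p) (fst (f p))"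
    using interleaved_interval_sum_injection[OF int B B'] by blast
  obtain h where h: "inj_on h ?Q" "\<And>q. q \<in> ?Q \<Longrightarrow> h q \<in> bars B \<and> endpoints_close \<delta> (fst q) (fst (h q))"
    using interleaved_interval_sum_injection[OF interleaved_sym[OF int] B' B] by blast
  obtain m where m: "inj_on fst m" "inj_on snd m" "?P \<subseteq> fst ` m" "?Q \<subseteq> snd ` m"
    "m \<subseteq> (\<lambda>p. (p, f p)) ` ?P \<union> (\<lambda>q. (h q, q)) ` ?Q"
    using glue_partial_injections[OF f(1) h(1)] by blast
  \<comment> \<open>Edges from \<open>h\<close> point backwards, which is harmless because closeness
    is symmetric.\<close>
  have edge: "p \<in> bars B \<and> q \<in> bars B' \<and> endpoints_close \<delta> (fst p) (fst q)" if "(p, q) \<in> m" for p q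
    using that m(5) f(2)[of p] h(2)[of q] by (auto simp: long_bars_def endpoints_close_def)
  have "death (fst p) \<le> birth (fst p) + ereal (2 * \<delta>)" if "p \<in> bars B - fst ` m" for p
    using that m(3) by (force simp: long_bars_def)
  moreover have "death (fst q) \<le> birth (fst q) + ereal (2 * \<delta>)" if "q \<in> bars B' - snd ` m" for q
    using that m(4) by (force simp: long_bars_def)
  moreover have "m \<subseteq> bars B \<times> bars B'" using edge by auto
  moreover have "\<forall>((I, i), (J, j))\<in>m. birth I \<le> birth J + ereal \<delta> \<and> birth J \<le> birth I + ereal \<delta> \<and>
      death I \<le> death J + ereal \<delta> \<and> death J \<le> death I + ereal \<delta>"
  proof (safe)
    fix I J :: "real set" and i j assume "((I, i), (J, j)) \<in> m"
    from edge[OF this] show "birth I \<le> birth J + ereal \<delta>" "birth J \<le> birth I + ereal \<delta>"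
      "death I \<le> death J + ereal \<delta>" "death J \<le> death I + ereal \<delta>"
      by (simp_all add: endpoints_close_def)
  qed
  ultimately have "matching \<delta> B B' m"
    unfolding matching_def using m(1,2) by (intro conjI) (auto simp del: split_paired_All)
  then show ?thesis ..
qed

section \<open>Transport of interleavings along isomorphisms\<close>

text \<open>The pointwise inverses are linear and natural because an element of \<open>M\<close> is
  determined by its image under \<open>f\<close>. The closure properties of \<open>M\<close> place
  the expected preimages in its carriers.\<close>

lemma pmod_isomorphic_inverse:
  fixes M :: "('k::field, 'a) pmod"
  assumes M: "persistence_module M" and iso: "pmod_isomorphic M N"
  obtains f k where "shift_morphism 0 M N f" "shift_morphism 0 N M k"
    "\<And>t x. x \<in> carrier (pspace M t) \<Longrightarrow> k t (f t x) = x"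
    "\<And>t y. y \<in> carrier (pspace N t) \<Longrightarrow> f t (k t y) = y"
proof -
  interpret persistence_module M by fact
  obtain f where f: "shift_morphism 0 M N f"
    and bij: "\<And>t. bij_betw (f t) (carrier (pspace M t)) (carrier (pspace N t))"
    using iso unfolding pmod_isomorphic_def by blast
  define k where "k t = inv_into (carrier (pspace M t)) (f t)" for t
  have kc: "k t y \<in> carrier (pspace M t)" and fk: "f t (k t y) = y" if "y \<in> carrier (pspace N t)" for t y
    unfolding k_def using bij_betw_imp_surj_on[OF bij[of t]] that
    by (auto intro: inv_into_into f_inv_into_f)
  have kf: "k t (f t x) = x" if "x \<in> carrier (pspace M t)" for t x
    unfolding k_def using bij that by (simp add: bij_betw_def)
  have k_eq: "k t y = x" if "x \<in> carrier (pspace M t)" "f t x = y" for t x y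
    using kf that by blast
  have f_lin: "f t \<in> linear_maps (pspace M t) (pspace N t)" for t
    using f unfolding shift_morphism_def by simp
  have f_nat: "f t (pmap M s t x) = pmap N s t (f s x)" if "s \<le> t" "x \<in> carrier (pspace M s)" for s t x
    using f that unfolding shift_morphism_def by simp
  have "k t \<in> linear_maps (pspace N t) (pspace M t)" for t
  proof -
    interpret V: Module.module ring_of_type_algebra "pspace M t" by (rule module)
    have "k t (y \<oplus>\<^bsub>pspace N t\<^esub> z) = k t y \<oplus>\<^bsub>pspace M t\<^esub> k t z"
      if "y \<in> carrier (pspace N t)" "z \<in> carrier (pspace N t)" for y z
      using that f_lin[of t] kc fk by (intro k_eq V.a_closed) (auto simp: linear_maps_def)
    moreover have "k t (a \<odot>\<^bsub>pspace N t\<^esub> y) = a \<odot>\<^bsub>pspace M t\<^esub> k t y"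
      if "y \<in> carrier (pspace N t)" for a y
      using that f_lin[of t] kc fk
      by (intro k_eq V.smult_closed) (auto simp: linear_maps_def ring_of_type_algebra_def)
    ultimately show ?thesis unfolding linear_maps_def using kc by blast
  qed
  moreover have "k t (pmap N s t y) = pmap M s t (k s y)"
    if "s \<le> t" "y \<in> carrier (pspace N s)" for s t y
  proof (rule k_eq)
    show "pmap M s t (k s y) \<in> carrier (pspace M t)"
      using linear[OF that(1)] kc[OF that(2)] by (auto simp: linear_maps_def)
    show "f t (pmap M s t (k s y)) = pmap N s t y"
      using f_nat[OF that(1) kc[OF that(2)]] fk[OF that(2)] by simp
  qed
  ultimately have "shift_morphism 0 N M k" unfolding shift_morphism_def by simp
  then show thesis using that f kf fk by blast
qed

text \<open>The inner pair \<open>k'\<close>, \<open>f'\<close> cancels, \<open>hg\<close> turns the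
  middle into a structure map of \<open>M\<close>, and naturality of \<open>f\<close> carries it to
  \<open>M'\<close>. Both round trips of the conjugated interleaving are instances.\<close>

lemma interleaving_transport_half:
  assumes g: "shift_morphism \<delta> M N g" and h: "shift_morphism \<delta> N M h" and "0 \<le> \<delta>"
    and hg: "\<And>t x. x \<in> carrier (pspace M t) \<Longrightarrow> h (t + \<delta>) (g t x) = pmap M t (t + 2 * \<delta>) x"
    and f: "shift_morphism 0 M M' f" and k: "shift_morphism 0 M' M k"
    and fk: "\<And>t x. x \<in> carrier (pspace M' t) \<Longrightarrow> f t (k t x) = x"
    and kf': "\<And>t y. y \<in> carrier (pspace N t) \<Longrightarrow> k' t (f' t y) = y"
    and x: "x \<in> carrier (pspace M' t)"
  shows "f (t + \<delta> + \<delta>) (h (t + \<delta>) (k' (t + \<delta>) (f' (t + \<delta>) (g t (k t x))))) = pmap M' t (t + 2 * \<delta>) x"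
proof -
  have kx: "k t x \<in> carrier (pspace M t)" using k x by (auto simp: shift_morphism_def linear_maps_def)
  then have "g t (k t x) \<in> carrier (pspace N (t + \<delta>))" using g by (auto simp: shift_morphism_def linear_maps_def)
  from kf'[OF this] have inner: "h (t + \<delta>) (k' (t + \<delta>) (f' (t + \<delta>) (g t (k t x)))) = pmap M t (t + 2 * \<delta>) (k t x)"
    by (simp only: hg[OF kx])
  have "f (t + 2 * \<delta>) (pmap M t (t + 2 * \<delta>) (k t x)) = pmap M' t (t + 2 * \<delta>) x"
    using f kx \<open>0 \<le> \<delta>\<close> fk[OF x] by (simp add: shift_morphism_def)
  moreover have "t + \<delta> + \<delta> = t + 2 * \<delta>" by simp
  ultimately show ?thesis unfolding inner by (simp only:)
qed

lemma interleaved_isomorphic: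
  fixes M N :: "('k::field, 'a) pmod"
  assumes "persistence_module M" "persistence_module N"
    and "pmod_isomorphic M M'" "pmod_isomorphic N N'" and "interleaved \<delta> M N"
  shows "interleaved \<delta> M' N'"
proof -
  obtain f k where f: "shift_morphism 0 M M' f" and k: "shift_morphism 0 M' M k"
    and kf: "\<And>t x. x \<in> carrier (pspace M t) \<Longrightarrow> k t (f t x) = x"
    and fk: "\<And>t y. y \<in> carrier (pspace M' t) \<Longrightarrow> f t (k t y) = y"
    using pmod_isomorphic_inverse[OF assms(1,3)] by blast
  obtain f' k' where f': "shift_morphism 0 N N' f'" and k': "shift_morphism 0 N' N k'"
    and kf': "\<And>t x. x \<in> carrier (pspace N t) \<Longrightarrow> k' t (f' t x) = x"
    and fk': "\<And>t y. y \<in> carrier (pspace N' t) \<Longrightarrow> f' t (k' t y) = y"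
    using pmod_isomorphic_inverse[OF assms(2,4)] by blast
  obtain g h where \<delta>: "0 \<le> \<delta>" and g: "shift_morphism \<delta> M N g" and h: "shift_morphism \<delta> N M h"
    and hg: "\<And>t x. x \<in> carrier (pspace M t) \<Longrightarrow> h (t + \<delta>) (g t x) = pmap M t (t + 2 * \<delta>) x"
    and gh: "\<And>t y. y \<in> carrier (pspace N t) \<Longrightarrow> g (t + \<delta>) (h t y) = pmap N t (t + 2 * \<delta>) y"
    using assms(5) unfolding interleaved_def by blast
  \<comment> \<open>Conjugates of \<open>g\<close> and \<open>h\<close> by the isomorphisms, which
    have shift 0.\<close>
  define G where "G t x = f' (t + \<delta>) (g t (k t x))" for t x
  define H where "H t y = f (t + \<delta>) (h t (k' t y))" for t y
  have "shift_morphism \<delta> M' N' G"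
    using shift_morphism_comp[OF shift_morphism_comp[OF k g] f'] by (simp add: G_def[abs_def])
  moreover have "shift_morphism \<delta> N' M' H"
    using shift_morphism_comp[OF shift_morphism_comp[OF k' h] f] by (simp add: H_def[abs_def])
  moreover have "H (t + \<delta>) (G t x) = pmap M' t (t + 2 * \<delta>) x" if "x \<in> carrier (pspace M' t)" for t x
    unfolding H_def G_def
    by (rule interleaving_transport_half[where g = g and h = h and f = f and k = k and f' = f' and k' = k',
          OF g h \<delta> hg f k fk kf' that])
  moreover have "G (t + \<delta>) (H t x) = pmap N' t (t + 2 * \<delta>) x" if "x \<in> carrier (pspace N' t)" for t x
    unfolding H_def G_def
    by (rule interleaving_transport_half[where g = h and h = g and f = f' and k = k' and f' = f and k' = k,
          OF h g \<delta> gh f' k' fk' kf that])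
  ultimately show ?thesis unfolding interleaved_def using \<delta> by blast
qed

section \<open>Interleaving of persistent homology\<close>

lemma boundaries_mono: "S \<subseteq> T \<Longrightarrow> boundaries S n \<subseteq> boundaries T n"
  unfolding boundaries_def chain_space_def functions_on_def by (intro image_mono) auto

lemma cycles_mono: "S \<subseteq> T \<Longrightarrow> cycles S n \<subseteq> cycles T n"
  unfolding cycles_def chain_space_def functions_on_def by auto

lemma homology_inclusion_linear:
  fixes S T :: "'v::linorder set set"
  assumes "finite T" "S \<subseteq> T"
  shows "homology_inclusion T n \<in> linear_maps (homology S n :: ('k::field, ('v, 'k) chain set) module) (homology T n)"
proof -
  have "finite S" using assms finite_subset by blast
  note sB = lin_subspace_boundaries[OF \<open>finite S\<close>] lin_subspace_boundaries[OF \<open>finite T\<close>]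
  note I = homology_inclusion_coset[OF sB(2,1) boundaries_mono[OF assms(2)]]
  show ?thesis
    unfolding homology_subquotient linear_maps_def subquotient_carrier
    using cycles_mono[OF assms(2), of n] by (auto simp: I coset_add[OF sB(1)] coset_add[OF sB(2)] coset_smult[OF sB(1)] coset_smult[OF sB(2)])
qed

text \<open>An inclusion keeps the representing cycle, so both sides are the class of the same
  \<open>z\<close>. Naturality and the round trips of the interleaving reduce to this.\<close>

lemma homology_inclusion_comp:
  fixes x :: "('v::linorder, 'k::field) chain set"
  assumes "finite U" "S \<subseteq> T" "T \<subseteq> U" "x \<in> carrier (homology S n)"
  shows "homology_inclusion U n (homology_inclusion T n x) = homology_inclusion U n x"
proof -
  have "finite T" using assms(1,3) by (rule rev_finite_subset)
  then have "finite S" using assms(2) by (rule rev_finite_subset)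
  note sB = lin_subspace_boundaries[OF \<open>finite T\<close>] lin_subspace_boundaries[OF \<open>finite S\<close>] lin_subspace_boundaries[OF \<open>finite U\<close>]
  obtain z where "x = coset (boundaries S n) z"
    using assms(4) unfolding homology_subquotient subquotient_carrier by blast
  then show ?thesis
    by (simp add: homology_inclusion_coset[OF sB(1,2) boundaries_mono[OF assms(2)]]
      homology_inclusion_coset[OF sB(3,1) boundaries_mono[OF assms(3)]]
      homology_inclusion_coset[OF sB(3,2) boundaries_mono[OF order_trans[OF assms(2,3)]]])
qed

lemma sublevel_mono: "\<lbrakk>s \<le> t; \<And>\<sigma>. \<sigma> \<in> K \<Longrightarrow> g \<sigma> \<le> f \<sigma> + \<delta>\<rbrakk> \<Longrightarrow> sublevel K f s \<subseteq> sublevel K g (t + \<delta>)"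
  unfolding sublevel_def by force

lemma shift_morphism_persistent_homology:
  fixes K :: "'v::linorder set set"
  assumes K: "finite K" and "0 \<le> \<delta>" and fg: "\<And>\<sigma>. \<sigma> \<in> K \<Longrightarrow> g \<sigma> \<le> f \<sigma> + \<delta>"
  shows "shift_morphism \<delta> (persistent_homology K f n :: ('k::field, ('v, 'k) chain set) pmod)
    (persistent_homology K g n) (\<lambda>t. homology_inclusion (sublevel K g (t + \<delta>)) n)"
proof -
  have fin: "finite (sublevel K h t)" for h t using K by (simp add: sublevel_def)
  have self: "sublevel K h s \<subseteq> sublevel K h t" if "s \<le> t" for h s t
    using that unfolding sublevel_def by force
  note fg' = sublevel_mono[of _ _ K g f \<delta>, OF _ fg]
  \<comment> \<open>Both paths around the square equal the direct inclusion.\<close>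
  have "homology_inclusion (sublevel K g (t + \<delta>)) n (homology_inclusion (sublevel K f t) n x) =
    homology_inclusion (sublevel K g (t + \<delta>)) n (homology_inclusion (sublevel K g (s + \<delta>)) n x)"
    if "s \<le> t" "x \<in> carrier (homology (sublevel K f s) n)" for s t and x :: "('v, 'k) chain set"
    using homology_inclusion_comp[OF fin self[OF that(1)] fg'[OF order_refl] that(2)]
      homology_inclusion_comp[OF fin fg'[OF order_refl] self that(2), of "t + \<delta>"] that(1) by simp
  then show ?thesis
    unfolding shift_morphism_def persistent_homology_def pmod.simps
    using homology_inclusion_linear[OF fin fg'[OF order_refl]] by blast
qed

lemma interleaved_persistent_homology:
  fixes K :: "'v::linorder set set"
  assumes K: "finite K" and "0 \<le> \<delta>" and fg: "\<And>\<sigma>. \<sigma> \<in> K \<Longrightarrow> \<bar>f \<sigma> - g \<sigma>\<bar> \<le> \<delta>"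
  shows "interleaved \<delta> (persistent_homology K f n :: ('k::field, ('v, 'k) chain set) pmod) (persistent_homology K g n)"
proof -
  have fin: "finite (sublevel K h t)" for h t using K by (simp add: sublevel_def)
  have le: "\<And>\<sigma>. \<sigma> \<in> K \<Longrightarrow> g \<sigma> \<le> f \<sigma> + \<delta>" "\<And>\<sigma>. \<sigma> \<in> K \<Longrightarrow> f \<sigma> \<le> g \<sigma> + \<delta>"
    using fg by (force simp: abs_le_iff)+
  \<comment> \<open>Stated for arbitrary \<open>f\<close> and \<open>g\<close> because it is used
    with both orders of the two filtrations.\<close>
  have round_trip: "homology_inclusion (sublevel K f (t + \<delta> + \<delta>)) n (homology_inclusion (sublevel K g (t + \<delta>)) n x) =
      homology_inclusion (sublevel K f (t + 2 * \<delta>)) n x"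
    if "\<And>\<sigma>. \<sigma> \<in> K \<Longrightarrow> g \<sigma> \<le> f \<sigma> + \<delta>" "\<And>\<sigma>. \<sigma> \<in> K \<Longrightarrow> f \<sigma> \<le> g \<sigma> + \<delta>"
      "x \<in> carrier (homology (sublevel K f t) n)" for f g t and x :: "('v, 'k) chain set"
  proof -
    have "t + \<delta> + \<delta> = t + 2 * \<delta>" by simp
    then show ?thesis
      using homology_inclusion_comp[OF fin sublevel_mono[OF order_refl that(1)] sublevel_mono[OF order_refl that(2)] that(3)]
      by (simp only:)
  qed
  show ?thesis
    unfolding interleaved_def
  proof (intro conjI exI allI ballI)
    show "shift_morphism \<delta> (persistent_homology K f n :: ('k, ('v, 'k) chain set) pmod)
      (persistent_homology K g n) (\<lambda>t. homology_inclusion (sublevel K g (t + \<delta>)) n)"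
      by (rule shift_morphism_persistent_homology[OF K \<open>0 \<le> \<delta>\<close> le(1)])
    show "shift_morphism \<delta> (persistent_homology K g n :: ('k, ('v, 'k) chain set) pmod)
      (persistent_homology K f n) (\<lambda>t. homology_inclusion (sublevel K f (t + \<delta>)) n)"
      by (rule shift_morphism_persistent_homology[OF K \<open>0 \<le> \<delta>\<close> le(2)])
  qed (simp_all only: persistent_homology_def pmod.simps round_trip[OF le] round_trip[OF le(2,1)] \<open>0 \<le> \<delta>\<close>)
qed

section \<open>The supremum distance and the stability bounds\<close>

lemma sup_dist_finite:
  assumes "finite K"
  obtains \<delta> where "0 \<le> \<delta>" "sup_dist K f g = ennreal \<delta>" "\<And>\<sigma>. \<sigma> \<in> K \<Longrightarrow> \<bar>f \<sigma> - g \<sigma>\<bar> \<le> \<delta>"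
proof -
  \<comment> \<open>The supremum over a finite complex is attained; inserting 0 covers the empty
    complex.\<close>
  define \<delta> where "\<delta> = Max (insert 0 ((\<lambda>\<sigma>. \<bar>f \<sigma> - g \<sigma>\<bar>) ` K))"
  have ge: "0 \<le> \<delta>" "\<And>\<sigma>. \<sigma> \<in> K \<Longrightarrow> \<bar>f \<sigma> - g \<sigma>\<bar> \<le> \<delta>"
    unfolding \<delta>_def using assms by (auto intro!: Max_ge)
  have "sup_dist K f g \<le> ennreal \<delta>"
    unfolding sup_dist_def using ge by (intro SUP_least ennreal_leI) auto
  moreover have "\<delta> = 0 \<or> \<delta> \<in> (\<lambda>\<sigma>. \<bar>f \<sigma> - g \<sigma>\<bar>) ` K"
    using Max_in[of "insert 0 ((\<lambda>\<sigma>. \<bar>f \<sigma> - g \<sigma>\<bar>) ` K)"] assms unfolding \<delta>_def by auto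
  then have "ennreal \<delta> \<le> sup_dist K f g"
    unfolding sup_dist_def by (auto intro: SUP_upper)
  ultimately show thesis using that ge by (metis antisym)
qed

theorem theorem10:
  fixes K :: "'v::linorder set set"
    and absv :: "'k::field_char_0 \<Rightarrow> real"
    and sc :: "'k \<Rightarrow> 'a::ab_group_add \<Rightarrow> 'a"
    and E :: "'a set"
    and nrm :: "'a \<Rightarrow> real"
    and \<phi> :: "'a \<Rightarrow> 'v set \<Rightarrow> real"
    and H :: "'a \<Rightarrow> nat \<Rightarrow> ('k, ('v, 'k) chain set) pmod"
    and c c' :: 'a
  assumes "finite_simplicial_complex K"
    and "absolute_value absv"
    and "finite_dimensional_vector_space sc E"
    and "norm_wrt absv sc nrm"
    and "\<forall>a. filtration_function K (\<phi> a)"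
    and "\<forall>a. H a = persistent_homology K (\<phi> a)"
  shows "interleaving_distance (H c) (H c') \<le> sup_dist K (\<phi> c) (\<phi> c') \<and>
    (\<forall>B B'. is_barcode B (H c) \<and> is_barcode B' (H c') \<longrightarrow>
      bottleneck_distance B B' \<le> sup_dist K (\<phi> c) (\<phi> c')) \<and>
    (\<forall>L\<ge>0. (\<forall>a a'. sup_dist K (\<phi> a) (\<phi> a') \<le> ennreal (L * nrm (a - a'))) \<longrightarrow>
      interleaving_distance (H c) (H c') \<le> ennreal (L * nrm (c - c')))"
proof -
  let ?S = "sup_dist K (\<phi> c) (\<phi> c')"
  have K: "finite K" using assms(1) by (rule finite_simplicial_complexD)
  obtain \<delta> where \<delta>: "0 \<le> \<delta>" "?S = ennreal \<delta>" "\<And>\<sigma>. \<sigma> \<in> K \<Longrightarrow> \<bar>\<phi> c \<sigma> - \<phi> c' \<sigma>\<bar> \<le> \<delta>"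
    using sup_dist_finite[OF K, of "\<phi> c" "\<phi> c'"] by blast
  \<comment> \<open>The interleaving exists at \<open>\<delta>\<close> itself, so
    \<open>\<delta>\<close> belongs to the sets whose infima are the distances and no limit is
    taken.\<close>
  have int: "interleaved \<delta> (H c n) (H c' n)" for n
    using assms(6) by (simp add: interleaved_persistent_homology[OF K \<delta>(1,3)])
  have pm: "persistence_module (H a n)" for a n
    using assms(5,6) by (simp add: persistence_module_homology[OF assms(1)])
  have distance: "interleaving_distance (H c) (H c') \<le> ?S"
    unfolding interleaving_distance_def \<delta>(2) using \<delta>(1) int by (intro Inf_lower) blast
  moreover have "bottleneck_distance B B' \<le> ?S" if B: "is_barcode B (H c)" "is_barcode B' (H c')" for B B'
  proof -
    have "\<exists>m. matching \<delta> (B n) (B' n) m" for n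
    proof (rule interleaved_interval_sum_matching)
      show "interleaved \<delta> (interval_sum (B n) :: ('k, _) pmod) (interval_sum (B' n))"
        using B by (intro interleaved_isomorphic[OF pm pm _ _ int]) (auto simp: is_barcode_def)
    qed (use B in \<open>auto simp: is_barcode_def\<close>)
    then show ?thesis
      unfolding bottleneck_distance_def \<delta>(2) using \<delta>(1) by (intro Inf_lower) blast
  qed
  \<comment> \<open>The Lipschitz bound at \<open>c\<close> and \<open>c'\<close> is chained with
    \<open>distance\<close>.\<close>
  ultimately show ?thesis using order_trans[OF distance] by blast
qed

end
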